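(* Let $H=(V,E)$ be a $\beta$-acyclic hypergraph. The multilinear set $f_H$ of $H$ can be computed by a d-DNNF of size $\mathrm{poly}(|V|,|E|)$, which can be constructed from $H$ in time $\mathrm{poly}(|V|,|E|)$.
   Context: A hypergraph is a pair $H=(V,E)$ with $V$ finite and $E\subseteq 2^V$. A vertex $v$ is a nest point if the edges containing $v$ are totally ordered by inclusion. For $W\subseteq V$, $H\setminus W$ has vertex set $V\setminus W$ and edge set $\{e\setminus W:e\in E\}$. $H$ is $\beta$-acyclic if there is an ordering $(v_1,\dots,v_n)$ of $V$ such that each $v_i$ is a nest point of $H\setminus\{v_1,\dots,v_{i-1}\}$. The multilinear set $f_H$ is the set of all $\tau\in\{0,1\}^{X\cup Y}$, $X=\{x_v\}_{v\in V}$, $Y=\{y_e\}_{e\in E}$, such that $\tau(y_e)=\prod_{v\in e}\tau(x_v)$ for every $e\in E$. An NNF circuit $C$ on a finite variable set $Z$ is a finite directed acyclic graph with a designated output node $\mathrm{out}(C)$, in which every node of in-degree $0$ (an input of $C$) is labeled by $0$, $1$, or a literal $z$ or $\neg z$ with $z\in Z$, and every other node is labeled $\wedge$ or $\vee$. The inputs of a node $v$ are the nodes $w$ with an edge $w\to v$. $\mathrm{var}(v)$ is the set of variables $z\in Z$ such that there is a (possibly trivial) path from an input labeled $z$ or $\neg z$ to $v$. Each node $v$ computes $f_v\subseteq\{0,1\}^{\mathrm{var}(v)}$: an input labeled $0$ computes $\emptyset$; one labeled $1$ computes $\{0,1\}^\emptyset$; one labeled $z$ (resp. $\neg z$) computes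 the single assignment $z\mapsto1$ (resp. $z\mapsto 0$); if $v$ is a $\vee$-node then $\tau\in f_v$ iff $\tau|_{\mathrm{var}(w)}\in f_w$ for some input $w$ of $v$; if $v$ is a $\wedge$-node then $\tau\in f_v$ iff $\tau|_{\mathrm{var}(w)}\in f_w$ for all inputs $w$ of $v$. The circuit computes $f_C=f_{\mathrm{out}(C)}\times\{0,1\}^{Z\setminus\mathrm{var}(\mathrm{out}(C))}$. The size $|C|$ is the number of edges. A $\wedge$-node is decomposable if its distinct inputs $w,w'$ satisfy $\mathrm{var}(w)\cap\mathrm{var}(w')=\emptyset$. A $\vee$-node $v$ is deterministic if for every $\tau\in f_v$ there is a unique input $w$ of $v$ with $\tau|_{\mathrm{var}(w)}\in f_w$. A d-DNNF is an NNF circuit in which all $\wedge$-nodes are decomposable and all $\vee$-nodes are deterministic. *)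

theory Defs
  imports "HOL-Library.FuncSet" "HOL-Computational_Algebra.Polynomial"
begin

section \<open>Hypergraphs and multilinear sets\<close>

definition hypergraph :: "'a set \<Rightarrow> 'a set set \<Rightarrow> bool" where
  "hypergraph V E \<longleftrightarrow> finite V \<and> E \<subseteq> Pow V"

definition nest_point :: "'a set \<Rightarrow> 'a set set \<Rightarrow> 'a \<Rightarrow> bool" where
  "nest_point V E v \<longleftrightarrow> v \<in> V \<and> chain\<^sub>\<subseteq> {e \<in> E. v \<in> e}"

definition delete_from_edges :: "'a set set \<Rightarrow> 'a set \<Rightarrow> 'a set set" where
  "delete_from_edges E W = (\<lambda>e. e - W) ` E"

definition beta_acyclic :: "'a set \<Rightarrow> 'a set set \<Rightarrow> bool" where
  "beta_acyclic V E \<longleftrightarrow>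
     (\<exists>vs. distinct vs \<and> set vs = V \<and>
        (\<forall>i < length vs.
           nest_point (V - set (take i vs)) (delete_from_edges E (set (take i vs))) (vs ! i)))"

datatype 'a mlvar = Xvar 'a | Yvar "'a set"

definition mlvars :: "'a set \<Rightarrow> 'a set set \<Rightarrow> 'a mlvar set" where
  "mlvars V E = Xvar ` V \<union> Yvar ` E"

text \<open>
  The set of all 0/1-assignments on \<open>S\<close>, with \<^const>\<open>True\<close> for 1 and \<^const>\<open>False\<close> for 0.
  Assignments are extensional functions, so that \<^const>\<open>restrict\<close> is the restriction to a
  smaller set of variables.
\<close>
definition assignments :: "'z set \<Rightarrow> ('z \<Rightarrow> bool) set" where
  "assignments S = S \<rightarrow>\<^sub>E UNIV"

definition multilinear_set :: "'a set \<Rightarrow> 'a set set \<Rightarrow> ('a mlvar \<Rightarrow> bool) set" where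
  "multilinear_set V E =
     {\<tau> \<in> assignments (mlvars V E).
        \<forall>e \<in> E. (of_bool (\<tau> (Yvar e)) :: nat) = (\<Prod>v\<in>e. of_bool (\<tau> (Xvar v)))}"


section \<open>NNF circuits\<close>

datatype 'z gate = Zero | One | Pos 'z | Neg 'z | And_gate | Or_gate

record ('n, 'z) circuit =
  nodes :: "'n set"
  wires :: "('n \<times> 'n) set"
  gate_of :: "'n \<Rightarrow> 'z gate"
  out_node :: 'n

definition inputs :: "('n, 'z) circuit \<Rightarrow> 'n \<Rightarrow> 'n set" where
  "inputs C v = {w. (w, v) \<in> wires C}"

definition nnf_circuit :: "'z set \<Rightarrow> ('n, 'z) circuit \<Rightarrow> bool" where
  "nnf_circuit Z C \<longleftrightarrow>
     finite Z \<and> finite (nodes C) \<and> wires C \<subseteq> nodes C \<times> nodes C \<and> acyclic (wires C) \<and>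
     out_node C \<in> nodes C \<and>
     (\<forall>v \<in> nodes C.
        if inputs C v = {} then gate_of C v \<in> {Zero, One} \<union> Pos ` Z \<union> Neg ` Z
        else gate_of C v \<in> {And_gate, Or_gate})"

definition var :: "('n, 'z) circuit \<Rightarrow> 'n \<Rightarrow> 'z set" where
  "var C v = {z. \<exists>u \<in> nodes C. gate_of C u \<in> {Pos z, Neg z} \<and> (u, v) \<in> (wires C)\<^sup>*}"

text \<open>
  \<open>accepts C v \<tau>\<close> means that \<open>\<tau>\<close> belongs to the set computed by the node \<open>v\<close>.  On a finite
  acyclic circuit the rules are a recursion along the wires, so the least fixed point is the
  only one.  There is no rule for \<^const>\<open>Zero\<close>.
\<close>
inductive accepts :: "('n, 'z) circuit \<Rightarrow> 'n \<Rightarrow> ('z \<Rightarrow> bool) \<Rightarrow> bool" for C where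
  One: "gate_of C v = One \<Longrightarrow> \<tau> \<in> assignments {} \<Longrightarrow> accepts C v \<tau>"
| Pos: "gate_of C v = Pos z \<Longrightarrow> \<tau> \<in> assignments {z} \<Longrightarrow> \<tau> z \<Longrightarrow> accepts C v \<tau>"
| Neg: "gate_of C v = Neg z \<Longrightarrow> \<tau> \<in> assignments {z} \<Longrightarrow> \<not> \<tau> z \<Longrightarrow> accepts C v \<tau>"
| Or: "gate_of C v = Or_gate \<Longrightarrow> \<tau> \<in> assignments (var C v) \<Longrightarrow>
       w \<in> inputs C v \<Longrightarrow> accepts C w (restrict \<tau> (var C w)) \<Longrightarrow> accepts C v \<tau>"
| And: "gate_of C v = And_gate \<Longrightarrow> \<tau> \<in> assignments (var C v) \<Longrightarrow>
        \<forall>w \<in> inputs C v. accepts C w (restrict \<tau> (var C w)) \<Longrightarrow> accepts C v \<tau>"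

definition computed_at :: "('n, 'z) circuit \<Rightarrow> 'n \<Rightarrow> ('z \<Rightarrow> bool) set" where
  "computed_at C v = {\<tau>. accepts C v \<tau>}"

definition computed_set :: "'z set \<Rightarrow> ('n, 'z) circuit \<Rightarrow> ('z \<Rightarrow> bool) set" where
  "computed_set Z C =
     {\<tau> \<in> assignments Z. restrict \<tau> (var C (out_node C)) \<in> computed_at C (out_node C)}"

definition circuit_size :: "('n, 'z) circuit \<Rightarrow> nat" where
  "circuit_size C = card (wires C)"

definition decomposable :: "('n, 'z) circuit \<Rightarrow> 'n \<Rightarrow> bool" where
  "decomposable C v \<longleftrightarrow>
     (\<forall>w \<in> inputs C v. \<forall>w' \<in> inputs C v. w \<noteq> w' \<longrightarrow> var C w \<inter> var C w' = {})"

definition deterministic :: "('n, 'z) circuit \<Rightarrow> 'n \<Rightarrow> bool" where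
  "deterministic C v \<longleftrightarrow>
     (\<forall>\<tau> \<in> computed_at C v. \<exists>!w. w \<in> inputs C v \<and> restrict \<tau> (var C w) \<in> computed_at C w)"

definition d_DNNF :: "'z set \<Rightarrow> ('n, 'z) circuit \<Rightarrow> bool" where
  "d_DNNF Z C \<longleftrightarrow> nnf_circuit Z C \<and>
     (\<forall>v \<in> nodes C. gate_of C v = And_gate \<longrightarrow> decomposable C v) \<and>
     (\<forall>v \<in> nodes C. gate_of C v = Or_gate \<longrightarrow> deterministic C v)"


section \<open>Programs and running time\<close>

text \<open>
  The model of computation is a random access machine with the unit-cost measure, programmed in
  a while language.  A state assigns a natural number to every cell of every named array; a
  scalar variable is cell 0 of its array.  A program mentions finitely many arrays, so they can
  be interleaved in a single memory.  The only arithmetic operations are addition and truncated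
  subtraction: with these, numbers grow by a constant number of bits per step and polynomial
  time agrees with polynomial time on Turing machines.  (Multiplication at unit cost would
  break this.)
\<close>
type_synonym state = "string \<Rightarrow> nat \<Rightarrow> nat"

datatype aexp = Num nat | Cell string aexp | Plus aexp aexp | Minus aexp aexp

datatype bexp = Less aexp aexp | Not bexp | And bexp bexp

datatype com =
    Skip
  | Assign string aexp aexp
  | Seq com com
  | If bexp com com
  | While bexp com

primrec aval :: "aexp \<Rightarrow> state \<Rightarrow> nat" where
  "aval (Num k) s = k"
| "aval (Cell x a) s = s x (aval a s)"
| "aval (Plus a b) s = aval a s + aval b s"
| "aval (Minus a b) s = aval a s - aval b s"

primrec bval :: "bexp \<Rightarrow> state \<Rightarrow> bool" where
  "bval (Less a b) s \<longleftrightarrow> aval a s < aval b s"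
| "bval (Not b) s \<longleftrightarrow> \<not> bval b s"
| "bval (And b c) s \<longleftrightarrow> bval b s \<and> bval c s"

text \<open>
  \<open>run c s t s'\<close>: started in \<open>s\<close>, the program \<open>c\<close> halts in \<open>s'\<close> after \<open>t\<close> steps.
  \<open>Assign x a b\<close> is the assignment \<open>x[a] := b\<close>.
\<close>
inductive run :: "com \<Rightarrow> state \<Rightarrow> nat \<Rightarrow> state \<Rightarrow> bool" where
  Skip: "run Skip s 1 s"
| Assign: "run (Assign x a b) s 1 (s(x := (s x)(aval a s := aval b s)))"
| Seq: "run c s t s' \<Longrightarrow> run d s' t' s'' \<Longrightarrow> run (Seq c d) s (t + t') s''"
| IfTrue: "bval b s \<Longrightarrow> run c s t s' \<Longrightarrow> run (If b c d) s (t + 1) s'"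
| IfFalse: "\<not> bval b s \<Longrightarrow> run d s t s' \<Longrightarrow> run (If b c d) s (t + 1) s'"
| WhileFalse: "\<not> bval b s \<Longrightarrow> run (While b c) s 1 s"
| WhileTrue: "bval b s \<Longrightarrow> run c s t s' \<Longrightarrow> run (While b c) s' t' s'' \<Longrightarrow>
    run (While b c) s (t + t' + 1) s''"

lemma run_deterministic:
  "run c s t s' \<Longrightarrow> run c s u s'' \<Longrightarrow> u = t \<and> s'' = s'"
proof (induction arbitrary: u s'' rule: run.induct)
  case (Skip s)
  then show ?case by cases simp
next
  case (Assign x a b s)
  then show ?case by cases simp
next
  case (Seq c s t s' d t' s2)
  note IH = Seq.IH
  from Seq.prems show ?case
  proof cases
    case (Seq w s3 w')
    with IH(1)[of w s3] IH(2)[of w' s''] show ?thesis by simp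
  qed
next
  case (IfTrue b s c t s' d)
  note IH = IfTrue.IH
  from IfTrue.prems show ?case
  proof cases
    case (IfTrue w)
    with IH[of w s''] show ?thesis by simp
  qed (use IfTrue.hyps in simp)
next
  case (IfFalse b s d t s' c)
  note IH = IfFalse.IH
  from IfFalse.prems show ?case
  proof cases
    case (IfFalse w)
    with IH[of w s''] show ?thesis by simp
  qed (use IfFalse.hyps in simp)
next
  case (WhileFalse b s c)
  from WhileFalse.prems show ?case
    by cases (use WhileFalse.hyps in simp_all)
next
  case (WhileTrue b s c t s' t' s2)
  note IH = WhileTrue.IH
  from WhileTrue.prems show ?case
  proof cases
    case (WhileTrue w s3 w')
    with IH(1)[of w s3] IH(2)[of w' s''] show ?thesis by simp
  qed (use WhileTrue.hyps in simp)
qed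


section \<open>Encoding of inputs and outputs\<close>

text \<open>
  A hypergraph is given to a program as its incidence matrix, with respect to an enumeration
  \<open>vs\<close> of the vertices and an enumeration \<open>es\<close> of the edges: cell \<open>j * n + i\<close> of the array
  \<open>inc\<close> tells whether the \<open>i\<close>-th vertex lies in the \<open>j\<close>-th edge.  All other cells are 0.
\<close>
definition input_state :: "'a list \<Rightarrow> 'a set list \<Rightarrow> state" where
  "input_state vs es = (\<lambda>x k.
     if x = ''n'' \<and> k = 0 then length vs
     else if x = ''m'' \<and> k = 0 then length es
     else if x = ''inc'' \<and> k < length es * length vs
       then of_bool (vs ! (k mod length vs) \<in> es ! (k div length vs))
     else 0)"

text \<open>
  A gate is written as a kind together with, for literals, the position of its variable in the
  enumeration \<open>zs\<close> of the variables.  Kind 0, the initial content of a cell, encodes no gate,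
  so a program has to write out every node of its circuit.
\<close>
fun encodes_gate :: "'z list \<Rightarrow> nat \<Rightarrow> nat \<Rightarrow> 'z gate \<Rightarrow> bool" where
  "encodes_gate zs k p Zero \<longleftrightarrow> k = 1"
| "encodes_gate zs k p One \<longleftrightarrow> k = 2"
| "encodes_gate zs k p (Pos z) \<longleftrightarrow> k = 3 \<and> p < length zs \<and> zs ! p = z"
| "encodes_gate zs k p (Neg z) \<longleftrightarrow> k = 4 \<and> p < length zs \<and> zs ! p = z"
| "encodes_gate zs k p And_gate \<longleftrightarrow> k = 5"
| "encodes_gate zs k p Or_gate \<longleftrightarrow> k = 6"

definition encodes_circuit :: "'z list \<Rightarrow> state \<Rightarrow> (nat, 'z) circuit \<Rightarrow> bool" where
  "encodes_circuit zs s C \<longleftrightarrow>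
     nodes C = {..< s ''nodes'' 0} \<and>
     (\<forall>u \<in> nodes C. encodes_gate zs (s ''kind'' u) (s ''arg'' u) (gate_of C u)) \<and>
     wires C = (\<lambda>k. (s ''src'' k, s ''dst'' k)) ` {..< s ''wires'' 0} \<and>
     out_node C = s ''out'' 0"

definition mlvar_list :: "'a list \<Rightarrow> 'a set list \<Rightarrow> 'a mlvar list" where
  "mlvar_list vs es = map Xvar vs @ map Yvar es"

text \<open>Value at \<open>(x, y)\<close> of a polynomial in two variables.\<close>
definition poly2 :: "nat poly poly \<Rightarrow> nat \<Rightarrow> nat \<Rightarrow> nat" where
  "poly2 p x y = poly (poly p [:x:]) y"

end

theory Submission
  imports Defs
begin

text \<open>
  Why the theorem is true.  Fix a nest point elimination order.  A greedy choice of nest points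
  never gets stuck: if a set \<open>W\<close> of vertices has been removed, the first vertex of any given
  elimination order that is still present is a nest point again, because removing more vertices
  preserves the inclusions between the traces of edges (\<open>beta_acyclic_eliminable\<close>).

  For stage \<open>k\<close> of the elimination consider the preorder \<open>cluster k\<close> on edges, which starts as
  equality.  Eliminating the vertex of stage \<open>k\<close> puts below an edge \<open>e\<close> that contains it
  everything that lies below some edge \<open>f\<close> that also contains it and whose trace on the remaining
  vertices is contained in that of \<open>e\<close>.  Three facts make this work.  All edges below \<open>e\<close> have
  their remaining vertices inside \<open>e\<close> (\<open>cluster_trace_le\<close>).  The preorder is a forest: two edges
  with a common lower bound are comparable (\<open>cluster_forest\<close>), because the traces of the edges
  through a nest point form a chain.  And two edges that share an eliminated vertex are comparable
  (\<open>cluster_shared_vertex\<close>).  So clusters that are not nested share neither edges nor eliminated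
  vertices.

  The circuit has a node for every stage \<open>k\<close> and edge \<open>e\<close>.  It states that \<open>y\<^sub>h = \<Prod>x\<^sub>v\<close>, where \<open>v\<close>
  runs over the eliminated vertices of \<open>h\<close>, for all \<open>h\<close> in the cluster of \<open>e\<close>
  (\<open>holds_sub_node\<close>); in other words, the remaining vertices of \<open>e\<close> are taken to be 1.  If the
  vertex \<open>x\<close> of stage \<open>k\<close> lies in \<open>e\<close>, the node of stage \<open>k + 1\<close> branches on \<open>x\<close>.  For \<open>x = 1\<close>
  all members of the cluster keep their constraint of stage \<open>k\<close>; for \<open>x = 0\<close> the members through
  \<open>x\<close> have \<open>y\<^sub>h = 0\<close> and the others keep theirs.  In both cases the constraints that remain are the
  conjunction of the nodes of stage \<open>k\<close> for the maximal clusters (\<open>tops_members\<close>), which are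
  disjoint, so the conjunction is decomposable; the two branches differ in the literal of \<open>x\<close>, so
  the disjunction is deterministic.  The output is the conjunction over the maximal clusters of
  the last stage.  Each stage contributes three nodes per edge and the two literals of its vertex.

  The construction is a fixed nest of loops with bounds \<open>n\<close> and \<open>m\<close>, so it is written in a small
  language of such loops.  Every program of this language has a total denotation, and if it is
  well formed, its compiled form runs in time polynomial in \<open>n\<close> and \<open>m\<close> by a bound that is read off
  from the syntax (\<open>run_compile\<close>).  What remains is that the denotation of one particular program writes out the
  circuit (\<open>Compiler_correct\<close>).
\<close>

section \<open>Clusters of edges along an elimination order\<close>

text \<open>
  Edges are numbered below \<open>m\<close> and vertices below \<open>n\<close>, as a program sees them; \<open>A e v\<close> is the
  incidence matrix.
\<close>
locale incidence =
  fixes n m :: nat and A :: "nat \<Rightarrow> nat \<Rightarrow> bool"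
begin

definition trace_le :: "nat set \<Rightarrow> nat \<Rightarrow> nat \<Rightarrow> bool" where
  "trace_le W e f \<longleftrightarrow> (\<forall>i<n. i \<notin> W \<longrightarrow> A e i \<longrightarrow> A f i)"

definition nest :: "nat set \<Rightarrow> nat \<Rightarrow> bool" where
  "nest W v \<longleftrightarrow> v \<notin> W \<and>
     (\<forall>e<m. \<forall>f<m. A e v \<longrightarrow> A f v \<longrightarrow> trace_le W e f \<or> trace_le W f e)"

text \<open>
  The recursion mirrors the loop by which the program searches for a nest point.  If there is none,
  the value 0 is arbitrary.
\<close>
primrec last_nest :: "nat set \<Rightarrow> nat \<Rightarrow> nat" where
  "last_nest W 0 = 0"
| "last_nest W (Suc v) = (if nest W v then v else last_nest W v)"

primrec gone :: "nat \<Rightarrow> nat set" where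
  "gone 0 = {}"
| "gone (Suc k) = insert (last_nest (gone k) n) (gone k)"

definition ord :: "nat \<Rightarrow> nat" where
  "ord k = last_nest (gone k) n"

definition I :: "nat \<Rightarrow> nat \<Rightarrow> bool" where
  "I e k \<longleftrightarrow> A e (ord k)"

text \<open>
  \<open>cluster k h e\<close>: the edge \<open>h\<close> can be reached from \<open>e\<close> through the vertices eliminated before stage
  \<open>k\<close>, along edges whose remaining vertices lie in \<open>e\<close>.  If \<open>e\<close> contains the vertex of stage \<open>k\<close>, its
  cluster absorbs those of the smaller edges through this vertex; otherwise no member of the cluster
  contains the vertex, and the cluster stays as it was.
\<close>
primrec cluster :: "nat \<Rightarrow> nat \<Rightarrow> nat \<Rightarrow> bool" where
  "cluster 0 h e \<longleftrightarrow> h = e"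
| "cluster (Suc k) h e \<longleftrightarrow>
     (if I e k then \<exists>f<m. I f k \<and> trace_le (gone k) f e \<and> cluster k h f else cluster k h e)"

lemma gone_Suc: "gone (Suc k) = insert (ord k) (gone k)"
  by (simp add: ord_def)

lemma trace_le_refl [simp]: "trace_le W e e"
  by (simp add: trace_le_def)

lemma trace_le_trans: "trace_le W e f \<Longrightarrow> trace_le W f g \<Longrightarrow> trace_le W e g"
  by (simp add: trace_le_def)

lemma trace_le_Suc: "trace_le (gone k) e f \<Longrightarrow> trace_le (gone (Suc k)) e f"
  by (simp add: trace_le_def)

lemma last_nest_correct: "\<exists>u<v. nest W u \<Longrightarrow> nest W (last_nest W v) \<and> last_nest W v < v"
  by (induction v) (auto simp: less_Suc_eq)

lemma cluster_bound: "cluster k h e \<Longrightarrow> e < m \<Longrightarrow> h < m"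
  by (induction k arbitrary: e) (auto split: if_splits)

lemma cluster_refl: "e < m \<Longrightarrow> cluster k e e"
  by (induction k arbitrary: e) auto

text \<open>
  This is what makes the subproblem of \<open>e\<close> independent of the rest: once the remaining vertices of
  \<open>e\<close> are set to 1, no remaining vertex matters to the members of its cluster.
\<close>
lemma cluster_trace_le: "cluster k h e \<Longrightarrow> trace_le (gone k) h e"
proof (induction k arbitrary: e)
  case (Suc k)
  show ?case
  proof (cases "I e k")
    case True
    with Suc.prems obtain f where f: "trace_le (gone k) f e" "cluster k h f" by auto
    from f Suc.IH[of f] show ?thesis by (meson trace_le_Suc trace_le_trans)
  next
    case False
    with Suc show ?thesis by (metis cluster.simps(2) trace_le_Suc)
  qed
qed simp

lemma cluster_Suc: "cluster k h e \<Longrightarrow> e < m \<Longrightarrow> cluster (Suc k) h e"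
  by auto

lemma cluster_mono: "k \<le> k' \<Longrightarrow> cluster k h e \<Longrightarrow> e < m \<Longrightarrow> cluster k' h e"
  by (induction k' rule: dec_induct) (auto simp del: cluster.simps intro: cluster_Suc)

end

text \<open>
  The hypothesis covers every proper subset \<open>W\<close> of the vertices, so greedy elimination succeeds
  whatever choices it makes.
\<close>
locale eliminable = incidence +
  assumes nest_exists: "W \<subset> {..<n} \<Longrightarrow> \<exists>v<n. nest W v"
begin

lemma gone_properties: "k \<le> n \<Longrightarrow> gone k \<subseteq> {..<n} \<and> card (gone k) = k"
  and ord_properties: "k < n \<Longrightarrow> ord k < n \<and> nest (gone k) (ord k)"
proof -
  have main: "gone k \<subseteq> {..<n} \<and> card (gone k) = k
    \<and> (k < n \<longrightarrow> ord k < n \<and> nest (gone k) (ord k))" if "k \<le> n" for k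
    using that
  proof (induction k)
    case 0
    have "\<exists>v<n. nest {} v" if "0 < n"
    proof (rule nest_exists)
      show "{} \<subset> {..<n}" using that by blast
    qed
    then have "0 < n \<longrightarrow> ord 0 < n \<and> nest {} (ord 0)"
      using last_nest_correct[of n "{}"] unfolding ord_def gone.simps by blast
    then show ?case by simp
  next
    case (Suc k)
    then have IH: "gone k \<subseteq> {..<n}" "card (gone k) = k" "ord k < n" "nest (gone k) (ord k)"
      by simp_all
    then have fin: "finite (gone k)" using finite_subset by blast
    have sub: "gone (Suc k) \<subseteq> {..<n}" using IH unfolding gone_Suc by blast
    have card: "card (gone (Suc k)) = Suc k"
    proof -
      have "ord k \<notin> gone k" using IH(4) unfolding nest_def by blast
      then show ?thesis using IH(2) fin by (simp add: gone_Suc del: gone.simps)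
    qed
    have "\<exists>v<n. nest (gone (Suc k)) v" if "Suc k < n"
    proof (rule nest_exists)
      have "gone (Suc k) \<noteq> {..<n}" 
        using card that card_lessThan[of n] by (metis nat_neq_iff)
      with sub show "gone (Suc k) \<subset> {..<n}" by blast
    qed
    then show ?case using sub card last_nest_correct[of n "gone (Suc k)"]
      unfolding ord_def by blast
  qed
  show "k \<le> n \<Longrightarrow> gone k \<subseteq> {..<n} \<and> card (gone k) = k" using main by blast
  show "k < n \<Longrightarrow> ord k < n \<and> nest (gone k) (ord k)" using main by simp
qed

lemma gone_eq: "gone k = ord ` {..<k}"
  by (induction k) (simp_all add: gone_Suc lessThan_Suc del: gone.simps(2))

lemma gone_all: "gone n = {..<n}"
  using gone_properties[of n] by (simp add: card_subset_eq)

lemma ord_inj: "inj_on ord {..<n}"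
  using gone_properties[of n] by (simp add: gone_eq eq_card_imp_inj_on)

lemma ord_bound: "k < n \<Longrightarrow> ord k < n"
  using ord_properties by blast

lemma trace_le_I: "k < n \<Longrightarrow> trace_le (gone k) e f \<Longrightarrow> I e k \<Longrightarrow> I f k"
  using ord_properties[of k] by (auto simp: trace_le_def nest_def I_def)

lemma nest_I:
  "k < n \<Longrightarrow> e < m \<Longrightarrow> f < m \<Longrightarrow> I e k \<Longrightarrow> I f k \<Longrightarrow>
    trace_le (gone k) e f \<or> trace_le (gone k) f e"
  using ord_properties[of k] by (auto simp: nest_def I_def)

lemma cluster_I: "k < n \<Longrightarrow> cluster k h e \<Longrightarrow> I h k \<Longrightarrow> I e k"
  using cluster_trace_le trace_le_I by blast

lemma cluster_Suc_I: "k < n \<Longrightarrow> cluster (Suc k) h e \<Longrightarrow> I h k \<Longrightarrow> I e k"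
  using cluster_I[of k h e] by (auto split: if_splits)

text \<open>
  If \<open>f\<close> lies in the cluster of \<open>g\<close>, its trace is contained in that of \<open>g\<close>.  So whatever \<open>f\<close> absorbs at
  stage \<open>k\<close> is absorbed by \<open>g\<close> as well.
\<close>
lemma cluster_trans:
  "k \<le> n \<Longrightarrow> cluster k h f \<Longrightarrow> cluster k f g \<Longrightarrow> g < m \<Longrightarrow> cluster k h g"
proof (induction k arbitrary: f g)
  case (Suc k)
  then have k: "k < n" by simp
  have "f < m" using cluster_bound Suc.prems by blast
  show ?case
  proof (cases "I g k")
    case False
    then have "\<not> I f k" using cluster_Suc_I[OF k] Suc.prems by blast
    then show ?thesis using False Suc.IH[of f g] Suc.prems by simp
  next
    case True
    then obtain g' where g': "g' < m" "I g' k" "trace_le (gone k) g' g" "cluster k f g'"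
      using Suc.prems by auto
    show ?thesis
    proof (cases "I f k")
      case False
      then have "cluster k h g'" using Suc.IH[of f g'] Suc.prems g' by simp
      then show ?thesis using True g' by auto
    next
      case fk: True
      then obtain f' where f': "f' < m" "I f' k" "trace_le (gone k) f' f" "cluster k h f'"
        using Suc.prems by auto
      have "trace_le (gone k) f' g"
        using f'(3) cluster_trace_le[OF g'(4)] g'(3) trace_le_trans by blast
      then show ?thesis using True f' by auto
    qed
  qed
qed simp

lemma cluster_of_trace_le:
  "k < n \<Longrightarrow> e < m \<Longrightarrow> I e k \<Longrightarrow> trace_le (gone k) e f \<Longrightarrow> cluster (Suc k) e f"
  using cluster_refl trace_le_I by auto

text \<open>
  If both edges contain the vertex of stage \<open>k\<close>, their traces are comparable because it is a nest
  point, and then so are their clusters.  If only \<open>f\<close> does, then \<open>f\<close> absorbed \<open>h\<close> through some \<open>f'\<close>; by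
  the induction hypothesis \<open>f'\<close> is comparable with \<open>g\<close>, and it cannot be below \<open>g\<close>, which misses the
  vertex.
\<close>
lemma cluster_forest:
  "k \<le> n \<Longrightarrow> cluster k h f \<Longrightarrow> cluster k h g \<Longrightarrow> f < m \<Longrightarrow> g < m \<Longrightarrow>
    cluster k f g \<or> cluster k g f"
proof (induction k arbitrary: f g)
  case (Suc k)
  then have k: "k < n" by simp
  have one_sided: "cluster (Suc k) g f"
    if fg: "I f k" "\<not> I g k" "cluster (Suc k) h f" "cluster (Suc k) h g" "g < m" for f g
  proof -
    obtain f' where f': "f' < m" "I f' k" "trace_le (gone k) f' f" "cluster k h f'"
      using fg by auto
    have "cluster k h g" using fg by simp
    then have "cluster k f' g \<or> cluster k g f'" using Suc.IH[of f' g] f' fg k by simp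
    moreover have "\<not> cluster k f' g" using cluster_I[OF k] f' fg by blast
    ultimately show ?thesis using f' fg by auto
  qed
  show ?case
  proof (cases "I f k \<and> I g k")
    case True
    then show ?thesis using nest_I[OF k] cluster_of_trace_le[OF k] Suc.prems by meson
  next
    case False
    then consider "I f k" "\<not> I g k" | "\<not> I f k" "I g k" | "\<not> I f k" "\<not> I g k" by blast
    then show ?thesis
    proof cases
      case 3
      then show ?thesis using Suc.IH[of f g] Suc.prems by simp
    qed (use one_sided Suc.prems in blast)+
  qed
qed simp

text \<open>
  The nest point of stage \<open>i\<close> makes the two edges comparable at once, and clusters only grow.
\<close>
lemma cluster_shared_vertex:
  assumes "i < k" "k \<le> n" "h < m" "h' < m" "I h i" "I h' i"
  shows "cluster k h h' \<or> cluster k h' h"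
proof -
  have "cluster (Suc i) h h' \<or> cluster (Suc i) h' h"
    using nest_I[of i h h'] cluster_of_trace_le[of i] assms by auto
  then show ?thesis using cluster_mono[of "Suc i" k] assms by (meson Suc_leI)
qed

end

text \<open>
  The maximal elements of \<open>D\<close> in a preorder, with one representative for each class of equivalent
  elements, namely the smallest number.
\<close>
definition tops :: "(nat \<Rightarrow> nat \<Rightarrow> bool) \<Rightarrow> nat set \<Rightarrow> nat set" where
  "tops Q D = {f \<in> D. \<forall>g\<in>D. Q f g \<longrightarrow> Q g f \<and> f \<le> g}"

lemma tops_subset: "tops Q D \<subseteq> D"
  by (auto simp: tops_def)

lemma tops_antichain: "f \<in> tops Q D \<Longrightarrow> g \<in> tops Q D \<Longrightarrow> Q f g \<Longrightarrow> f = g"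
  by (auto simp: tops_def intro: order_antisym)

text \<open>
  Being dominated, in the sense of the negation of the condition in \<open>tops\<close>, is a strict order, so
  climbing along it ends in the finite set \<open>D\<close>.
\<close>
lemma tops_cover:
  assumes fin: "finite D" and refl: "\<And>f. f \<in> D \<Longrightarrow> Q f f"
    and trans: "\<And>f g h. f \<in> D \<Longrightarrow> g \<in> D \<Longrightarrow> h \<in> D \<Longrightarrow> Q f g \<Longrightarrow> Q g h \<Longrightarrow> Q f h"
    and "f \<in> D"
  shows "\<exists>t\<in>tops Q D. Q f t"
proof -
  define dom where "dom f g \<longleftrightarrow> Q f g \<and> \<not> (Q g f \<and> f \<le> g)" for f g
  have dom_trans: "dom f h" if "dom f g" "dom g h" "f \<in> D" "g \<in> D" "h \<in> D" for f g h
  proof -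
    have "\<not> (Q h f \<and> f \<le> h)"
    proof
      assume "Q h f \<and> f \<le> h"
      moreover from this have "Q g f" "Q h g"
        using that trans[of g h f] trans[of h f g] unfolding dom_def by blast+
      ultimately show False using that unfolding dom_def by linarith
    qed
    then show ?thesis using that trans[of f g h] unfolding dom_def by blast
  qed
  show ?thesis using \<open>f \<in> D\<close>
  proof (induction "card {g \<in> D. dom f g}" arbitrary: f rule: less_induct)
    case less
    show ?case
    proof (cases "f \<in> tops Q D")
      case True
      then show ?thesis using refl less.prems by blast
    next
      case False
      then obtain g where g: "g \<in> D" "dom f g"
        using less.prems unfolding tops_def dom_def by blast
      have "\<not> dom g g" by (simp add: dom_def)
      then have "{h \<in> D. dom g h} \<subset> {h \<in> D. dom f h}"
        using dom_trans[OF g(2)] g less.prems by blast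
      then have "card {h \<in> D. dom g h} < card {h \<in> D. dom f h}"
        using fin by (intro psubset_card_mono) auto
      then obtain t where t: "t \<in> tops Q D" "Q g t" using less.hyps g by blast
      then have "Q f t" using trans[of f g t] g less.prems tops_subset[of Q D] unfolding dom_def by blast
      then show ?thesis using t by blast
    qed
  qed
qed

section \<open>Semantics of circuit nodes\<close>

text \<open>
  An assignment to all variables is cut down to those of the node.  Restrictions to the variables
  of the inputs of a node then compose, so that the gates act as the plain connectives, and it
  does not matter which variables a node has exactly.
\<close>
definition holds :: "('n, 'z) circuit \<Rightarrow> 'n \<Rightarrow> ('z \<Rightarrow> bool) \<Rightarrow> bool" where
  "holds C v \<tau> \<longleftrightarrow> accepts C v (restrict \<tau> (var C v))"

lemma var_input: "w \<in> inputs C v \<Longrightarrow> var C w \<subseteq> var C v"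
  by (auto simp: var_def inputs_def intro: rtrancl_into_rtrancl)

lemma var_unfold:
  assumes "v \<in> nodes C"
  shows "var C v = {z. gate_of C v \<in> {Pos z, Neg z}} \<union> (\<Union>w\<in>inputs C v. var C w)"
proof (intro equalityI subsetI)
  fix z assume "z \<in> var C v"
  then obtain u where u: "u \<in> nodes C" "gate_of C u \<in> {Pos z, Neg z}" "(u, v) \<in> (wires C)\<^sup>*"
    by (auto simp: var_def)
  from u(3) show "z \<in> {z. gate_of C v \<in> {Pos z, Neg z}} \<union> (\<Union>w\<in>inputs C v. var C w)"
  proof (cases rule: rtranclE)
    case base
    then show ?thesis using u by simp
  next
    case (step w)
    then show ?thesis using u by (auto simp: inputs_def var_def)
  qed
next
  fix z assume "z \<in> {z. gate_of C v \<in> {Pos z, Neg z}} \<union> (\<Union>w\<in>inputs C v. var C w)"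
  then show "z \<in> var C v" using assms var_input[of _ C v] by (auto simp: var_def[of C v])
qed

lemma var_Int_input: "w \<in> inputs C v \<Longrightarrow> var C v \<inter> var C w = var C w"
  using var_input[of w C v] by blast

lemma restrict_in_assignments: "restrict \<tau> S \<in> assignments S"
  by (simp add: assignments_def)

lemma holds_One:
  assumes "v \<in> nodes C" "inputs C v = {}" "gate_of C v = One"
  shows "holds C v \<tau>"
proof -
  have "var C v = {}" using var_unfold[OF assms(1)] assms by simp
  then show ?thesis using accepts.One[OF assms(3)] restrict_in_assignments[of \<tau> "{}"]
    by (simp add: holds_def)
qed

lemma holds_Pos:
  assumes "v \<in> nodes C" "inputs C v = {}" "gate_of C v = Pos z"
  shows "holds C v \<tau> \<longleftrightarrow> \<tau> z"
proof -
  have "var C v = {z}" using var_unfold[OF assms(1)] assms by auto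
  then show ?thesis using assms(3) restrict_in_assignments[of \<tau> "{z}"]
    by (auto simp: holds_def accepts.simps[of C v])
qed

lemma holds_Neg:
  assumes "v \<in> nodes C" "inputs C v = {}" "gate_of C v = Neg z"
  shows "holds C v \<tau> \<longleftrightarrow> \<not> \<tau> z"
proof -
  have "var C v = {z}" using var_unfold[OF assms(1)] assms by auto
  then show ?thesis using assms(3) restrict_in_assignments[of \<tau> "{z}"]
    by (auto simp: holds_def accepts.simps[of C v])
qed

lemma holds_Or:
  assumes "gate_of C v = Or_gate"
  shows "holds C v \<tau> \<longleftrightarrow> (\<exists>w\<in>inputs C v. holds C w \<tau>)"
  using assms restrict_in_assignments[of \<tau> "var C v"]
  by (auto simp: holds_def accepts.simps[of C v] var_Int_input)

lemma holds_And:
  assumes "gate_of C v = And_gate"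
  shows "holds C v \<tau> \<longleftrightarrow> (\<forall>w\<in>inputs C v. holds C w \<tau>)"
  using assms restrict_in_assignments[of \<tau> "var C v"]
  by (auto simp: holds_def accepts.simps[of C v] var_Int_input)

text \<open>
  An accepted assignment is defined on the variables of the node only, so it is its own
  restriction and the exclusiveness of the inputs under \<open>holds\<close> applies to it.
\<close>
lemma deterministic_if_exclusive:
  assumes gate: "gate_of C v = Or_gate"
    and excl: "\<And>w w' \<tau>. w \<in> inputs C v \<Longrightarrow> w' \<in> inputs C v \<Longrightarrow> holds C w \<tau> \<Longrightarrow> holds C w' \<tau> \<Longrightarrow> w = w'"
  shows "deterministic C v"
  unfolding deterministic_def
proof
  fix \<tau> assume \<tau>: "\<tau> \<in> computed_at C v"
  then have "\<tau> \<in> assignments (var C v)"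
    using gate by (auto simp: computed_at_def accepts.simps[of C v])
  then have "restrict \<tau> (var C v) = \<tau>"
    by (auto simp: assignments_def intro: extensional_restrict PiE_restrict)
  then have "holds C v \<tau>" using \<tau> by (simp add: holds_def computed_at_def)
  then obtain w where w: "w \<in> inputs C v" "holds C w \<tau>" using holds_Or[OF gate] by blast
  show "\<exists>!w. w \<in> inputs C v \<and> restrict \<tau> (var C w) \<in> computed_at C w"
  proof (rule ex1I[of _ w])
    show "w \<in> inputs C v \<and> restrict \<tau> (var C w) \<in> computed_at C w"
      using w by (simp add: holds_def computed_at_def)
    show "w' = w" if "w' \<in> inputs C v \<and> restrict \<tau> (var C w') \<in> computed_at C w'" for w'
      using that excl[of w' w \<tau>] w by (simp add: holds_def computed_at_def)
  qed
qed

lemma computed_set_holds: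
  "computed_set Z C = {\<tau> \<in> assignments Z. holds C (out_node C) \<tau>}"
  by (simp add: computed_set_def computed_at_def holds_def)

section \<open>The circuit of an elimination order\<close>

text \<open>
  The literals are those of the edge variable of edge \<open>j\<close> and of the vertex variable of stage \<open>k\<close>.
  \<open>Split k e\<close> is the node of stage \<open>k + 1\<close> for edge \<open>e\<close>; \<open>Case1\<close> and \<open>Case0\<close> are its two branches.
  \<open>Triv\<close> is the constant 1.  It feeds the output \<open>Root\<close>, which would have no inputs if there are no
  edges.
\<close>
datatype node =
    Ypos nat | Yneg nat | Xpos nat | Xneg nat
  | Case1 nat nat | Case0 nat nat | Split nat nat
  | Triv | Root

context incidence
begin

text \<open>
  At stage 0 the product over the eliminated vertices is empty, hence the literal.
\<close>
definition sub_node :: "nat \<Rightarrow> nat \<Rightarrow> node" where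
  "sub_node k e = (case k of 0 \<Rightarrow> Ypos e | Suc k' \<Rightarrow> Split k' e)"

lemma sub_node_simps [simp]: "sub_node 0 e = Ypos e" "sub_node (Suc k) e = Split k e"
  by (simp_all add: sub_node_def)

definition members :: "nat \<Rightarrow> nat \<Rightarrow> nat set" where
  "members k e = {h. cluster k h e}"

text \<open>
  The branches of \<open>Split k e\<close> are present even if \<open>e\<close> misses the vertex of stage \<open>k\<close>.  They are not
  wired to it in that case, since the vertex must not enter its variables.
\<close>
primrec inp :: "node \<Rightarrow> node set" where
  "inp (Ypos j) = {}"
| "inp (Yneg j) = {}"
| "inp (Xpos k) = {}"
| "inp (Xneg k) = {}"
| "inp (Case1 k e) = insert (Xpos k) (sub_node k ` tops (cluster k) (members (Suc k) e))"
| "inp (Case0 k e) = insert (Xneg k)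
     (Yneg ` {h \<in> members (Suc k) e. I h k} \<union>
      sub_node k ` tops (cluster k) {h \<in> members (Suc k) e. \<not> I h k})"
| "inp (Split k e) = (if I e k then {Case1 k e, Case0 k e} else {sub_node k e})"
| "inp Triv = {}"
| "inp Root = insert Triv (sub_node n ` tops (cluster n) {..<m})"

definition stage_nodes :: "nat \<Rightarrow> node set" where
  "stage_nodes k = {Xpos k, Xneg k} \<union> Case1 k ` {..<m} \<union> Case0 k ` {..<m} \<union> Split k ` {..<m}"

primrec nodes_upto :: "nat \<Rightarrow> node set" where
  "nodes_upto 0 = Ypos ` {..<m} \<union> Yneg ` {..<m}"
| "nodes_upto (Suc k) = nodes_upto k \<union> stage_nodes k"

definition all_nodes :: "node set" where
  "all_nodes = nodes_upto n \<union> {Triv, Root}"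

text \<open>
  The first number used by stage \<open>k\<close>: each stage takes two literals and three nodes per edge, and
  the \<open>2 * m\<close> literals of the edge variables come first.
\<close>
definition base :: "nat \<Rightarrow> nat" where
  "base k = 2 * m + k * (3 * m + 2)"

primrec code :: "node \<Rightarrow> nat" where
  "code (Ypos j) = j"
| "code (Yneg j) = m + j"
| "code (Xpos k) = base k"
| "code (Xneg k) = base k + 1"
| "code (Case1 k e) = base k + 2 + e"
| "code (Case0 k e) = base k + 2 + m + e"
| "code (Split k e) = base k + 2 + 2 * m + e"
| "code Triv = base n"
| "code Root = base n + 1"

definition wire_set :: "node set \<Rightarrow> (nat \<times> nat) set" where
  "wire_set D = (\<Union>v\<in>D. (\<lambda>u. (code u, code v)) ` inp v)"

lemma base_Suc: "base (Suc k) = base k + (3 * m + 2)"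
  by (simp add: base_def)

lemma base_0: "base 0 = 2 * m"
  by (simp add: base_def)

lemma base_mono: "k \<le> k' \<Longrightarrow> base k \<le> base k'"
  unfolding base_def by (intro add_left_mono mult_right_mono) simp_all

lemma image_add_lessThan: "(\<lambda>j. a + j) ` {..<b} = {a..<a + b :: nat}"
  by (simp add: lessThan_atLeast0 add.commute)

lemma code_stage_nodes: "code ` stage_nodes k = {base k..<base (Suc k)}"
proof -
  have "code ` stage_nodes k = {base k, base k + 1} \<union> {base k + 2..<base k + 2 + m} \<union>
      {base k + 2 + m..<base k + 2 + m + m} \<union> {base k + 2 + 2 * m..<base k + 2 + 2 * m + m}"
    by (simp only: stage_nodes_def image_Un image_insert image_image image_empty code.simps
        image_add_lessThan)
  also have "\<dots> = {base k..<base (Suc k)}"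
    by (auto simp: base_Suc)
  finally show ?thesis .
qed

lemma code_nodes_upto: "code ` nodes_upto k = {..<base k}"
proof (induction k)
  case 0
  have "code ` nodes_upto 0 = {..<m} \<union> {m..<m + m}"
    by (simp add: image_Un image_image image_add_lessThan del: image_add_atLeastLessThan')
  then show ?case by (auto simp: base_0)
next
  case (Suc k)
  then show ?case using base_mono[of k "Suc k"]
    by (simp add: image_Un code_stage_nodes ivl_disj_un)
qed

lemma code_all_nodes: "code ` all_nodes = {..<base n + 2}"
  by (auto simp: all_nodes_def image_Un code_nodes_upto)

lemma card_stage_nodes: "finite (stage_nodes k) \<and> card (stage_nodes k) \<le> 3 * m + 2"
proof -
  have "card (f ` {..<m}) \<le> m" for f :: "nat \<Rightarrow> node"
    using card_image_le[of "{..<m}" f] by simp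
  from this[of "Case1 k"] this[of "Case0 k"] this[of "Split k"]
  show ?thesis
    using card_Un_le[of "{Xpos k, Xneg k} \<union> Case1 k ` {..<m} \<union> Case0 k ` {..<m}" "Split k ` {..<m}"]
      card_Un_le[of "{Xpos k, Xneg k} \<union> Case1 k ` {..<m}" "Case0 k ` {..<m}"]
      card_Un_le[of "{Xpos k, Xneg k}" "Case1 k ` {..<m}"]
    by (simp add: stage_nodes_def)
qed

lemma card_nodes_upto: "finite (nodes_upto k) \<and> card (nodes_upto k) \<le> base k"
proof (induction k)
  case 0
  have "card (f ` {..<m}) \<le> m" for f :: "nat \<Rightarrow> node"
    using card_image_le[of "{..<m}" f] by simp
  from this[of Ypos] this[of Yneg] show ?case
    using card_Un_le[of "Ypos ` {..<m}" "Yneg ` {..<m}"] by (simp add: base_0)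
next
  case (Suc k)
  then show ?case
    using card_stage_nodes[of k] card_Un_le[of "nodes_upto k" "stage_nodes k"]
    by (simp add: base_Suc)
qed

text \<open>
  Numbers of nodes are counted instead of comparing the constructors pairwise: there are at most
  as many nodes as numbers, and all these numbers are taken.
\<close>
lemma code_inj: "inj_on code all_nodes"
proof (rule eq_card_imp_inj_on)
  show fin: "finite all_nodes" using card_nodes_upto[of n] by (simp add: all_nodes_def)
  have "card all_nodes \<le> base n + 2"
    using card_nodes_upto[of n] card_Un_le[of "nodes_upto n" "{Triv, Root}"]
    by (simp add: all_nodes_def)
  then show "card (code ` all_nodes) = card all_nodes"
    using card_image_le[OF fin, of code] by (simp add: code_all_nodes)
qed

lemma nodes_upto_mono: "k \<le> k' \<Longrightarrow> nodes_upto k \<subseteq> nodes_upto k'"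
  by (induction k' rule: dec_induct) auto

lemma stage_nodes_subset: "k < k' \<Longrightarrow> stage_nodes k \<subseteq> nodes_upto k'"
  using nodes_upto_mono[of "Suc k" k'] by auto

lemma sub_node_in: "e < m \<Longrightarrow> sub_node k e \<in> nodes_upto k"
  by (cases k) (auto simp: stage_nodes_def)

lemma code_less_base: "d \<in> nodes_upto k \<Longrightarrow> code d < base k"
  using code_nodes_upto[of k] by blast

lemma members_bound: "e < m \<Longrightarrow> members k e \<subseteq> {..<m}"
  using cluster_bound by (auto simp: members_def)

lemma Yneg_in: "e < m \<Longrightarrow> Yneg e \<in> nodes_upto k"
  using nodes_upto_mono[of 0 k] by auto

lemma inp_stage:
  assumes "v \<in> stage_nodes k" "u \<in> inp v"
  shows "u \<in> nodes_upto (Suc k) \<and> code u < code v"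
proof -
  have tops: "sub_node k f \<in> nodes_upto k"
    if "f \<in> tops (cluster k) D" "D \<subseteq> members (Suc k) e" "e < m" for f D e
    using that tops_subset[of "cluster k" D] members_bound[of e "Suc k"] sub_node_in by blast
  have low: "w \<in> nodes_upto (Suc k) \<and> code w < base k" if "w \<in> nodes_upto k" for w
    using that code_less_base by auto
  from assms(1) consider "v = Xpos k" | "v = Xneg k" | e where "e < m" "v = Case1 k e"
    | e where "e < m" "v = Case0 k e" | e where "e < m" "v = Split k e"
    by (auto simp: stage_nodes_def)
  then show ?thesis
  proof cases
    case (3 e)
    then consider "u = Xpos k" | "u \<in> nodes_upto k" using assms(2) tops[of _ _ e] by auto
    then show ?thesis using low[of u] 3 by cases (auto simp: stage_nodes_def)
  next
    case (4 e)
    then consider "u = Xneg k" | "u \<in> nodes_upto k"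
      using assms(2) tops[of _ "{h \<in> members (Suc k) e. \<not> I h k}" e] members_bound[of e "Suc k"] Yneg_in[of _ k] by auto
    then show ?thesis using low[of u] 4 by cases (auto simp: stage_nodes_def)
  next
    case (5 e)
    then consider "u = Case1 k e" | "u = Case0 k e" | "u \<in> nodes_upto k"
      using assms(2) sub_node_in[of e k] by (auto split: if_splits)
    then show ?thesis using low[of u] 5 by cases (auto simp: stage_nodes_def)
  qed (use assms(2) in auto)
qed

lemma all_nodes_cases [consumes 1, case_names Ypos Yneg Xpos Xneg Case1 Case0 Split Triv Root]:
  assumes "d \<in> all_nodes"
  obtains j where "j < m" "d = Ypos j" | j where "j < m" "d = Yneg j"
    | k where "k < n" "d = Xpos k" | k where "k < n" "d = Xneg k"
    | k e where "k < n" "e < m" "d = Case1 k e" | k e where "k < n" "e < m" "d = Case0 k e"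
    | k e where "k < n" "e < m" "d = Split k e" | "d = Triv" | "d = Root"
proof -
  have "(\<exists>j<m. d = Ypos j \<or> d = Yneg j) \<or>
      (\<exists>k<i. d = Xpos k \<or> d = Xneg k \<or> (\<exists>e<m. d = Case1 k e \<or> d = Case0 k e \<or> d = Split k e))"
    if "d \<in> nodes_upto i" for i
    using that by (induction i) (auto simp: stage_nodes_def less_Suc_eq)
  then show ?thesis using assms that unfolding all_nodes_def by blast
qed

lemma nodes_upto_cases:
  assumes "v \<in> nodes_upto k"
  shows "inp v = {} \<or> (\<exists>i<k. v \<in> stage_nodes i)"
  using assms by (induction k) (auto simp: less_Suc_eq)

text \<open>
  Wires lead to larger numbers, which gives acyclicity.
\<close>
lemma inp_all:
  assumes "v \<in> all_nodes" "u \<in> inp v"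
  shows "u \<in> all_nodes \<and> code u < code v"
proof -
  consider (inner) k where "k < n" "v \<in> stage_nodes k" | (root) "v = Root"
    using assms nodes_upto_cases[of v n] by (auto simp: all_nodes_def)
  then show ?thesis
  proof cases
    case (inner k)
    then show ?thesis
      using inp_stage[OF _ assms(2)] nodes_upto_mono[of "Suc k" n] by (auto simp: all_nodes_def)
  next
    case root
    then have "u = Triv \<or> u \<in> nodes_upto n"
      using assms tops_subset[of "cluster n" "{..<m}"] sub_node_in[of _ n] by auto
    then show ?thesis using root code_less_base[of u n] by (auto simp: all_nodes_def)
  qed
qed

lemma wire_set_subset: "wire_set all_nodes \<subseteq> {..<base n + 2} \<times> {..<base n + 2}"
  using inp_all code_all_nodes by (fastforce simp: wire_set_def)

lemma wire_set_acyclic: "acyclic (wire_set all_nodes)"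
proof (rule acyclic_subset)
  show "acyclic {(a, b). a < (b :: nat)}"
    by (rule wf_acyclic[OF wf_less])
  show "wire_set all_nodes \<subseteq> {(a, b). a < b}"
    using inp_all by (auto simp: wire_set_def)
qed

primrec gate :: "'z list \<Rightarrow> node \<Rightarrow> 'z gate" where
  "gate zs (Ypos j) = Pos (zs ! (n + j))"
| "gate zs (Yneg j) = Neg (zs ! (n + j))"
| "gate zs (Xpos k) = Pos (zs ! ord k)"
| "gate zs (Xneg k) = Neg (zs ! ord k)"
| "gate zs (Case1 k e) = And_gate"
| "gate zs (Case0 k e) = And_gate"
| "gate zs (Split k e) = Or_gate"
| "gate zs Triv = One"
| "gate zs Root = And_gate"

end

context eliminable
begin

text \<open>
  A conjunction over the members of all maximal clusters is one over all of \<open>D\<close>.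
\<close>
lemma tops_members:
  assumes "k \<le> n" "D \<subseteq> {..<m}" "\<And>h f. f \<in> D \<Longrightarrow> cluster k h f \<Longrightarrow> h \<in> D"
  shows "(\<forall>f\<in>tops (cluster k) D. \<forall>h. cluster k h f \<longrightarrow> P h) \<longleftrightarrow> (\<forall>h\<in>D. P h)"
proof
  assume L: "\<forall>f\<in>tops (cluster k) D. \<forall>h. cluster k h f \<longrightarrow> P h"
  show "\<forall>h\<in>D. P h"
  proof
    fix h assume h: "h \<in> D"
    have "\<exists>t\<in>tops (cluster k) D. cluster k h t"
    proof (rule tops_cover)
      show "finite D" using assms(2) finite_subset by blast
      show "cluster k f f" if "f \<in> D" for f using that assms(2) cluster_refl by blast
      show "cluster k f h" if "h \<in> D" "cluster k f g" "cluster k g h" for f g h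
        using that assms(1,2) cluster_trans by blast
    qed (rule h)
    then show "P h" using L by blast
  qed
next
  assume "\<forall>h\<in>D. P h"
  then show "\<forall>f\<in>tops (cluster k) D. \<forall>h. cluster k h f \<longrightarrow> P h"
    using assms(3) tops_subset[of "cluster k" D] by blast
qed

lemma members_down:
  "k < n \<Longrightarrow> e < m \<Longrightarrow> f \<in> members (Suc k) e \<Longrightarrow> cluster k h f \<Longrightarrow> h \<in> members (Suc k) e"
  using cluster_trans[of "Suc k" h f e] cluster_Suc[of k h f] cluster_bound[of "Suc k" f e]
  by (simp add: members_def del: cluster.simps)

text \<open>
  The positions in the enumeration of the variables: vertices come first, so edge \<open>h\<close> has position
  \<open>n + h\<close>.
\<close>
definition vars_of :: "nat \<Rightarrow> nat \<Rightarrow> nat set" where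
  "vars_of k e = {n + h |h. cluster k h e} \<union> {ord i |i. i < k \<and> (\<exists>h. cluster k h e \<and> I h i)}"

lemma vars_of_bound: "k \<le> n \<Longrightarrow> e < m \<Longrightarrow> vars_of k e \<subseteq> {..<n + m}"
proof -
  assume k: "k \<le> n" and e: "e < m"
  have "n + h < n + m" if "cluster k h e" for h using cluster_bound[OF that e] by simp
  moreover have "ord i < n + m" if "i < k" for i using ord_bound[of i] that k by linarith
  ultimately show ?thesis unfolding vars_of_def by blast
qed

lemma vars_of_mono:
  assumes "k < n" "e < m" "f \<in> members (Suc k) e"
  shows "vars_of k f \<subseteq> vars_of (Suc k) e"
proof -
  have "cluster (Suc k) h e" if "cluster k h f" for h
    using members_down[OF assms that] unfolding members_def by blast
  then show ?thesis unfolding vars_of_def by (blast intro: less_SucI)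
qed

lemma vars_of_disjoint:
  assumes k: "k \<le> n" and fg: "f < m" "g < m" "\<not> cluster k f g" "\<not> cluster k g f"
  shows "vars_of k f \<inter> vars_of k g = {}"
proof -
  have no_common: False if "cluster k h f" "cluster k h g" for h
    using cluster_forest[OF k that] fg by blast
  have no_shared: False
    if "cluster k h f" "cluster k h' g" "I h i" "I h' i" "i < k" for h h' i
    using cluster_shared_vertex[of i k h h'] that k fg cluster_bound[of k] cluster_trans[of k]
      no_common by metis
  have same: "i = i'" if "ord i = ord i'" "i < k" "i' < k" for i i'
    using that k ord_inj by (auto simp: inj_on_def)
  show ?thesis
  proof (intro equals0I)
    fix p assume p: "p \<in> vars_of k f \<inter> vars_of k g"
    show False
    proof (cases "p < n")
      case True
      obtain i h where f: "p = ord i" "i < k" "cluster k h f" "I h i"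
        using p True unfolding vars_of_def by auto
      obtain i' h' where g: "p = ord i'" "i' < k" "cluster k h' g" "I h' i'"
        using p True unfolding vars_of_def by auto
      show False using f g same[of i i'] no_shared[of h h' i] by metis
    next
      case False
      then have "p \<noteq> ord i" if "i < k" for i using ord_bound[of i] that k by auto
      then obtain h h' where "p = n + h" "cluster k h f" "p = n + h'" "cluster k h' g"
        using p unfolding vars_of_def by blast
      then show False using no_common by simp
    qed
  qed
qed

lemma ord_notin_vars_of: "k < n \<Longrightarrow> ord k \<notin> vars_of k e"
proof -
  assume k: "k < n"
  have "ord k \<noteq> ord i" if "i < k" for i
    using inj_onD[OF ord_inj, of k i] that k by auto
  then show ?thesis using ord_bound[OF k] unfolding vars_of_def by auto
qed

lemma edge_notin_vars_of: "k \<le> n \<Longrightarrow> \<not> cluster k h e \<Longrightarrow> n + h \<notin> vars_of k e"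
proof -
  assume k: "k \<le> n" and h: "\<not> cluster k h e"
  have "n + h \<noteq> ord i" if "i < k" for i using ord_bound[of i] that k by linarith
  then show ?thesis using h unfolding vars_of_def by auto
qed

text \<open>
  Upper bounds for the variables below a node, which is all that decomposability needs.
\<close>
primrec vars_at :: "node \<Rightarrow> nat set" where
  "vars_at (Ypos j) = {n + j}"
| "vars_at (Yneg j) = {n + j}"
| "vars_at (Xpos k) = {ord k}"
| "vars_at (Xneg k) = {ord k}"
| "vars_at (Case1 k e) = vars_of (Suc k) e"
| "vars_at (Case0 k e) = vars_of (Suc k) e"
| "vars_at (Split k e) = vars_of (Suc k) e"
| "vars_at Triv = {}"
| "vars_at Root = {..<n + m}"

lemma vars_at_sub_node: "vars_at (sub_node k e) = vars_of k e"
  by (cases k) (auto simp: vars_of_def)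

lemma vars_at_bound: "v \<in> all_nodes \<Longrightarrow> vars_at v \<subseteq> {..<n + m}"
  by (erule all_nodes_cases) (simp_all add: vars_of_bound ord_bound trans_less_add1)

lemma tops_vars_disjoint:
  assumes "k \<le> n" "D \<subseteq> {..<m}" "f \<in> tops (cluster k) D" "g \<in> tops (cluster k) D" "f \<noteq> g"
  shows "vars_of k f \<inter> vars_of k g = {}"
  using vars_of_disjoint[OF assms(1), of f g] tops_antichain[of f "cluster k" D g]
    tops_antichain[of g "cluster k" D f] assms tops_subset[of "cluster k" D] by blast

lemma members_Suc_I: "k < n \<Longrightarrow> h \<in> members (Suc k) e \<Longrightarrow> I h k \<Longrightarrow> I e k"
  using cluster_Suc_I by (simp add: members_def del: cluster.simps)



text \<open>
  For the literals of the edge variables in \<open>Case0\<close>: an edge through the vertex of stage \<open>k\<close> lies in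
  no cluster of stage \<open>k\<close> of an edge that misses this vertex.
\<close>
lemma inp_disjoint:
  assumes v: "v \<in> all_nodes" "gate zs v = And_gate" and u: "u \<in> inp v" "u' \<in> inp v" "u \<noteq> u'"
  shows "vars_at u \<inter> vars_at u' = {}"
proof -
  have children: "vars_at (sub_node k f) \<inter> vars_at (sub_node k g) = {}"
    if "k \<le> n" "D \<subseteq> {..<m}" "f \<in> tops (cluster k) D" "g \<in> tops (cluster k) D"
      "sub_node k f \<noteq> sub_node k g" for k D f g
    using tops_vars_disjoint[OF that(1-4)] that(5) by (metis vars_at_sub_node)
  from v consider (c1) k e where "k < n" "e < m" "v = Case1 k e"
    | (c0) k e where "k < n" "e < m" "v = Case0 k e" | (root) "v = Root"
    by (cases rule: all_nodes_cases) simp_all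
  then show ?thesis
  proof cases
    case (c1 k e)
    define T where "T = tops (cluster k) (members (Suc k) e)"
    have dis: "vars_at (Xpos k) \<inter> vars_at (sub_node k f) = {}" for f
      using ord_notin_vars_of[OF c1(1)] by (simp add: vars_at_sub_node)
    have inp: "inp v = insert (Xpos k) (sub_node k ` T)" by (simp add: c1 T_def)
    have ch: "vars_at a \<inter> vars_at b = {}" if "a \<in> sub_node k ` T" "b \<in> sub_node k ` T" "a \<noteq> b" for a b
      using that children[of k "members (Suc k) e"] c1 members_bound[of e "Suc k"]
      unfolding T_def by auto
    show ?thesis using u ch dis unfolding inp by blast
  next
    case (c0 k e)
    define D where "D = {h \<in> members (Suc k) e. \<not> I h k}"
    define T where "T = tops (cluster k) D"
    define Y where "Y = {h \<in> members (Suc k) e. I h k}"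
    have D: "D \<subseteq> {..<m}" using members_bound[of e "Suc k"] c0 by (auto simp: D_def)
    have inp: "inp v = insert (Xneg k) (Yneg ` Y \<union> sub_node k ` T)"
      by (simp add: c0 T_def D_def Y_def)
    have xs: "vars_at (Xneg k) \<inter> vars_at (sub_node k f) = {}" for f
      using ord_notin_vars_of[OF c0(1)] by (simp add: vars_at_sub_node)
    have xy: "vars_at (Xneg k) \<inter> vars_at (Yneg h) = {}" for h
      using ord_bound[OF c0(1)] by simp
    have yy: "vars_at (Yneg h) \<inter> vars_at (Yneg h') = {}" if "Yneg h \<noteq> Yneg h'" for h h'
      using that by simp
    have ys: "vars_at (Yneg h) \<inter> vars_at (sub_node k f) = {}" if "h \<in> Y" "f \<in> T" for h f
    proof -
      have "\<not> cluster k h f"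
        using that cluster_I[OF c0(1), of h f] tops_subset[of "cluster k" D]
        by (auto simp: Y_def T_def D_def)
      then show ?thesis using edge_notin_vars_of[of k h f] c0 by (simp add: vars_at_sub_node)
    qed
    have ch: "vars_at a \<inter> vars_at b = {}" if "a \<in> sub_node k ` T" "b \<in> sub_node k ` T" "a \<noteq> b" for a b
      using that children[of k D] c0 D unfolding T_def by auto
    have "u = Xneg k \<or> u \<in> Yneg ` Y \<or> u \<in> sub_node k ` T"
      "u' = Xneg k \<or> u' \<in> Yneg ` Y \<or> u' \<in> sub_node k ` T"
      using u(1,2) unfolding inp by blast+
    then show ?thesis
    proof (elim disjE imageE)
      show ?thesis if "u = Xneg k" "u' = Xneg k" using that u(3) by blast
      show ?thesis if "u = sub_node k f" "u' = sub_node k g" "f \<in> T" "g \<in> T" for f g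
        using that u(3) ch[of u u'] by blast
    qed (use xs xy yy ys u(3) in \<open>simp_all add: Int_commute\<close>)
  next
    case root
    define T where "T = tops (cluster n) {..<m}"
    have inp: "inp v = insert Triv (sub_node n ` T)" by (simp add: root T_def)
    have ch: "vars_at a \<inter> vars_at b = {}" if "a \<in> sub_node n ` T" "b \<in> sub_node n ` T" "a \<noteq> b" for a b
      using that children[of n "{..<m}"] unfolding T_def by auto
    have t: "vars_at Triv = {}" by simp
    show ?thesis using u ch t unfolding inp by blast
  qed
qed

end

text \<open>
  Any circuit that is laid out as described by \<open>inp\<close>, \<open>gate\<close> and \<open>code\<close>, with the variables listed
  in \<open>zs\<close>.
\<close>
locale built_circuit = eliminable +
  fixes zs :: "'z list" and C :: "(nat, 'z) circuit"
  assumes zs: "distinct zs" "length zs = n + m"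
    and nodes_C: "nodes C = {..<base n + 2}"
    and wires_C: "wires C = wire_set all_nodes"
    and gate_C: "d \<in> all_nodes \<Longrightarrow> gate_of C (code d) = gate zs d"
    and out_C: "out_node C = code Root"
begin

lemma code_in_nodes: "d \<in> all_nodes \<Longrightarrow> code d \<in> nodes C"
  using code_all_nodes nodes_C by blast

lemma node_obtain: "v \<in> nodes C \<Longrightarrow> \<exists>d\<in>all_nodes. v = code d"
  using code_all_nodes nodes_C by (metis imageE)

lemma inputs_code:
  assumes "d \<in> all_nodes"
  shows "inputs C (code d) = code ` inp d"
  using assms inj_onD[OF code_inj] by (fastforce simp: inputs_def wires_C wire_set_def)

lemma var_code:
  assumes "d \<in> all_nodes"
  shows "var C (code d) = {z. gate zs d \<in> {Pos z, Neg z}} \<union> (\<Union>u\<in>inp d. var C (code u))"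
  using var_unfold[OF code_in_nodes[OF assms]] assms by (simp add: inputs_code gate_C)

lemma all_nodes_intros:
  "j < m \<Longrightarrow> Ypos j \<in> all_nodes" "j < m \<Longrightarrow> Yneg j \<in> all_nodes"
  "k < n \<Longrightarrow> Xpos k \<in> all_nodes" "k < n \<Longrightarrow> Xneg k \<in> all_nodes"
  "k < n \<Longrightarrow> e < m \<Longrightarrow> Case1 k e \<in> all_nodes" "k < n \<Longrightarrow> e < m \<Longrightarrow> Case0 k e \<in> all_nodes"
  "k < n \<Longrightarrow> e < m \<Longrightarrow> Split k e \<in> all_nodes"
  "Triv \<in> all_nodes" "Root \<in> all_nodes"
  using nodes_upto_mono[of 0 n] stage_nodes_subset[of k n]
  by (auto simp: all_nodes_def stage_nodes_def)

lemma var_inner: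
  "d \<in> all_nodes \<Longrightarrow> gate zs d \<in> {And_gate, Or_gate} \<Longrightarrow>
    var C (code d) = (\<Union>u\<in>inp d. var C (code u))"
  by (auto simp: var_code simp del: code.simps)

lemma var_literals:
  "j < m \<Longrightarrow> var C (code (Ypos j)) = {zs ! (n + j)}"
  "j < m \<Longrightarrow> var C (code (Yneg j)) = {zs ! (n + j)}"
  "k < n \<Longrightarrow> var C (code (Xpos k)) = {zs ! ord k}"
  "k < n \<Longrightarrow> var C (code (Xneg k)) = {zs ! ord k}"
  "var C (code Triv) = {}"
  by (simp_all add: var_code all_nodes_intros del: code.simps)

lemma var_sub_node:
  "k \<le> n \<Longrightarrow> e < m \<Longrightarrow> var C (code (sub_node k e)) \<subseteq> (!) zs ` vars_of k e"
proof (induction k arbitrary: e)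
  case 0
  then show ?case by (simp add: var_literals vars_of_def del: code.simps)
next
  case (Suc k)
  then have k: "k < n" and e: "e < m" by simp_all
  let ?S = "(!) zs ` vars_of (Suc k) e"
  have sub: "var C (code (sub_node k f)) \<subseteq> ?S" if "f \<in> members (Suc k) e" for f
  proof -
    have "f < m" using that members_bound[OF e] by blast
    then show ?thesis using Suc.IH[of f] k vars_of_mono[OF k e that] by (meson image_mono less_imp_le subset_trans)
  qed
  have tops_sub: "var C (code u) \<subseteq> ?S"
    if "u \<in> sub_node k ` tops (cluster k) D" "D \<subseteq> members (Suc k) e" for u D
    using that sub tops_subset[of "cluster k" D] by blast
  have self: "e \<in> members (Suc k) e"
    using cluster_refl[OF e, of "Suc k"] by (simp add: members_def del: cluster.simps)
  have neg: "var C (code (Yneg h)) \<subseteq> ?S" if "h \<in> members (Suc k) e" for h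
  proof -
    have "h < m" using that members_bound[OF e] by blast
    then show ?thesis using that by (auto simp: var_literals vars_of_def members_def simp del: code.simps cluster.simps)
  qed
  show ?case
  proof (cases "I e k")
    case True
    have "ord k \<in> vars_of (Suc k) e"
      using True self unfolding vars_of_def members_def by blast
    then have x: "var C (code (Xpos k)) \<subseteq> ?S" "var C (code (Xneg k)) \<subseteq> ?S"
      by (simp_all add: var_literals k del: code.simps)
    have "var C (code (Case1 k e)) \<subseteq> ?S"
    proof -
      have "var C (code u) \<subseteq> ?S" if "u \<in> inp (Case1 k e)" for u
        using that x(1) tops_sub[of u "members (Suc k) e"] unfolding inp.simps by blast
      then show ?thesis using var_inner[OF all_nodes_intros(5)[OF k e]] by (auto simp del: inp.simps code.simps)
    qed
    moreover have "var C (code (Case0 k e)) \<subseteq> ?S"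
    proof -
      have "var C (code u) \<subseteq> ?S" if "u \<in> inp (Case0 k e)" for u
        using that x(2) neg tops_sub[of u "{h \<in> members (Suc k) e. \<not> I h k}"]
        unfolding inp.simps by blast
      then show ?thesis using var_inner[OF all_nodes_intros(6)[OF k e]] by (auto simp del: inp.simps code.simps)
    qed
    ultimately show ?thesis
      using True var_inner[OF all_nodes_intros(7)[OF k e]] by (simp del: code.simps)
  next
    case False
    then show ?thesis
      using sub[OF self] var_inner[OF all_nodes_intros(7)[OF k e]] by (simp del: code.simps)
  qed
qed

lemma var_inp_And:
  assumes v: "v \<in> all_nodes" "gate zs v = And_gate" and u: "u \<in> inp v"
  shows "var C (code u) \<subseteq> (!) zs ` vars_at u"
proof -
  have "u \<in> all_nodes" using inp_all[OF v(1) u] by blast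
  moreover have "u = Triv \<or> (\<exists>k. u = Xpos k \<or> u = Xneg k) \<or> (\<exists>h. u = Yneg h) \<or>
      (\<exists>k f. u = sub_node k f)"
    using v(2) u by (cases v) auto
  moreover have "sub_node k f \<noteq> Case1 i e" "sub_node k f \<noteq> Case0 i e" "sub_node k f \<noteq> Root" for k f i e
    by (cases k; simp)+
  ultimately show ?thesis
  proof (cases rule: all_nodes_cases)
    case (Split k e)
    then show ?thesis using var_sub_node[of "Suc k" e] by simp
  next
    case (Case1 k e)
    then show ?thesis
      using \<open>u = Triv \<or> _\<close> \<open>\<And>k f i e. sub_node k f \<noteq> Case1 i e\<close> by (metis node.distinct)
  next
    case (Case0 k e)
    then show ?thesis
      using \<open>u = Triv \<or> _\<close> \<open>\<And>k f i e. sub_node k f \<noteq> Case0 i e\<close> by (metis node.distinct)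
  next
    case Root
    then show ?thesis
      using \<open>u = Triv \<or> _\<close> \<open>\<And>k f. sub_node k f \<noteq> Root\<close> by (metis node.distinct)
  qed (simp_all add: var_literals del: code.simps)
qed

lemma decomposable_nodes:
  assumes d: "d \<in> all_nodes" "gate zs d = And_gate"
  shows "decomposable C (code d)"
  unfolding decomposable_def inputs_code[OF d(1)]
proof (intro ballI impI)
  fix w w' assume w: "w \<in> code ` inp d" "w' \<in> code ` inp d" "w \<noteq> w'"
  then obtain u u' where u: "u \<in> inp d" "u' \<in> inp d" "w = code u" "w' = code u'" "u \<noteq> u'"
    by blast
  have "(!) zs ` vars_at u \<inter> (!) zs ` vars_at u' = {}"
  proof -
    have "inj_on ((!) zs) (vars_at u \<union> vars_at u')"
    proof (rule inj_on_nth[OF zs(1)])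
      show "\<forall>i\<in>vars_at u \<union> vars_at u'. i < length zs"
        using vars_at_bound[of u] vars_at_bound[of u'] inp_all[OF d(1) u(1)] inp_all[OF d(1) u(2)]
        unfolding zs(2) by blast
    qed
    then show ?thesis
      using inp_disjoint[OF d u(1,2,5)] by (metis inj_on_image_Int image_empty sup_ge1 sup_ge2)
  qed
  then show "var C w \<inter> var C w' = {}"
    using var_inp_And[OF d u(1)] var_inp_And[OF d u(2)] u(3,4) by blast
qed

lemma holds_literals:
  "j < m \<Longrightarrow> holds C (code (Ypos j)) \<tau> \<longleftrightarrow> \<tau> (zs ! (n + j))"
  "j < m \<Longrightarrow> holds C (code (Yneg j)) \<tau> \<longleftrightarrow> \<not> \<tau> (zs ! (n + j))"
  "k < n \<Longrightarrow> holds C (code (Xpos k)) \<tau> \<longleftrightarrow> \<tau> (zs ! ord k)"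
  "k < n \<Longrightarrow> holds C (code (Xneg k)) \<tau> \<longleftrightarrow> \<not> \<tau> (zs ! ord k)"
  "holds C (code Triv) \<tau>"
  using holds_Pos[OF code_in_nodes, of "Ypos j"] holds_Neg[OF code_in_nodes, of "Yneg j"]
    holds_Pos[OF code_in_nodes, of "Xpos k"] holds_Neg[OF code_in_nodes, of "Xneg k"]
    holds_One[OF code_in_nodes, of Triv]
  by (simp_all add: inputs_code gate_C all_nodes_intros del: code.simps)

lemma holds_And_code:
  "d \<in> all_nodes \<Longrightarrow> gate zs d = And_gate \<Longrightarrow>
    holds C (code d) \<tau> \<longleftrightarrow> (\<forall>u\<in>inp d. holds C (code u) \<tau>)"
  using holds_And[of C "code d"] by (simp add: inputs_code gate_C)

lemma holds_Or_code:
  "d \<in> all_nodes \<Longrightarrow> gate zs d = Or_gate \<Longrightarrow>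
    holds C (code d) \<tau> \<longleftrightarrow> (\<exists>u\<in>inp d. holds C (code u) \<tau>)"
  using holds_Or[of C "code d"] by (simp add: inputs_code gate_C)

text \<open>
  The constraint of edge \<open>h\<close>, with all vertices that are not yet eliminated set to 1.
\<close>
definition good :: "nat \<Rightarrow> ('z \<Rightarrow> bool) \<Rightarrow> nat \<Rightarrow> bool" where
  "good k \<tau> h \<longleftrightarrow> (\<tau> (zs ! (n + h)) \<longleftrightarrow> (\<forall>i<k. I h i \<longrightarrow> \<tau> (zs ! ord i)))"

text \<open>
  The invariant of the construction.  The members of a cluster are covered by the maximal clusters
  of the previous stage, separately among all members (if the new vertex is 1) and among those
  that miss the new vertex (if it is 0).
\<close>
lemma holds_sub_node:
  "k \<le> n \<Longrightarrow> e < m \<Longrightarrow> holds C (code (sub_node k e)) \<tau> \<longleftrightarrow> (\<forall>h\<in>members k e. good k \<tau> h)"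
proof (induction k arbitrary: e)
  case 0
  then show ?case by (simp add: holds_literals members_def good_def del: code.simps)
next
  case (Suc k)
  then have k: "k < n" and e: "e < m" by simp_all
  let ?x = "\<tau> (zs ! ord k)"
  have good_Suc: "good (Suc k) \<tau> h \<longleftrightarrow>
      (if I h k \<and> \<not> ?x then \<not> \<tau> (zs ! (n + h)) else good k \<tau> h)" for h
    by (auto simp: good_def less_Suc_eq)
  show ?case
  proof (cases "I e k")
    case True
    have tops: "(\<forall>f\<in>tops (cluster k) D. holds C (code (sub_node k f)) \<tau>) \<longleftrightarrow> (\<forall>h\<in>D. good k \<tau> h)"
      if D: "D \<subseteq> {..<m}" "\<And>h f. f \<in> D \<Longrightarrow> cluster k h f \<Longrightarrow> h \<in> D" for D
    proof -
      have "(\<forall>f\<in>tops (cluster k) D. holds C (code (sub_node k f)) \<tau>) \<longleftrightarrow>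
          (\<forall>f\<in>tops (cluster k) D. \<forall>h. cluster k h f \<longrightarrow> good k \<tau> h)"
      proof (rule ball_cong)
        fix f assume "f \<in> tops (cluster k) D"
        then have "f < m" using tops_subset[of "cluster k" D] D(1) by blast
        then show "holds C (code (sub_node k f)) \<tau> \<longleftrightarrow> (\<forall>h. cluster k h f \<longrightarrow> good k \<tau> h)"
          using Suc.IH[of f] k by (simp add: members_def)
      qed simp
      also have "\<dots> \<longleftrightarrow> (\<forall>h\<in>D. good k \<tau> h)"
        by (rule tops_members[OF less_imp_le[OF k] D(1)]) (rule D(2))
      finally show ?thesis .
    qed
    let ?M = "members (Suc k) e"
    let ?N = "{h \<in> ?M. \<not> I h k}"
    have t1: "(\<forall>f\<in>tops (cluster k) ?M. holds C (code (sub_node k f)) \<tau>) \<longleftrightarrow> (\<forall>h\<in>?M. good k \<tau> h)"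
      by (rule tops[OF members_bound[OF e] members_down[OF k e]])
    have t0: "(\<forall>f\<in>tops (cluster k) ?N. holds C (code (sub_node k f)) \<tau>) \<longleftrightarrow> (\<forall>h\<in>?N. good k \<tau> h)"
    proof (rule tops)
      show "?N \<subseteq> {..<m}" using members_bound[OF e] by blast
      show "h \<in> ?N" if "f \<in> ?N" "cluster k h f" for h f
        using that members_down[OF k e, of f h] cluster_I[OF k, of h f] by blast
    qed
    have neg: "(\<forall>h\<in>{h \<in> ?M. I h k}. holds C (code (Yneg h)) \<tau>) \<longleftrightarrow>
        (\<forall>h\<in>?M. I h k \<longrightarrow> \<not> \<tau> (zs ! (n + h)))"
      using members_bound[OF e] by (auto simp: holds_literals subset_iff simp del: code.simps)
    have c1: "holds C (code (Case1 k e)) \<tau> \<longleftrightarrow> ?x \<and> (\<forall>h\<in>?M. good k \<tau> h)"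
      using holds_And_code[OF all_nodes_intros(5)[OF k e]] t1 holds_literals(3)[OF k]
      by (simp del: code.simps)
    have c0: "holds C (code (Case0 k e)) \<tau> \<longleftrightarrow> \<not> ?x \<and>
        (\<forall>h\<in>?M. I h k \<longrightarrow> \<not> \<tau> (zs ! (n + h))) \<and> (\<forall>h\<in>?N. good k \<tau> h)"
      using holds_And_code[OF all_nodes_intros(6)[OF k e]] t0 neg holds_literals(4)[OF k]
      by (simp add: ball_Un del: code.simps)
    have "holds C (code (Split k e)) \<tau> \<longleftrightarrow>
        holds C (code (Case1 k e)) \<tau> \<or> holds C (code (Case0 k e)) \<tau>"
      using holds_Or_code[OF all_nodes_intros(7)[OF k e]] True by (simp del: code.simps)
    then show ?thesis using c1 c0 by (auto simp: good_Suc simp del: code.simps)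
  next
    case False
    have "good (Suc k) \<tau> h \<longleftrightarrow> good k \<tau> h" if "h \<in> members (Suc k) e" for h
      using members_Suc_I[OF k that] False good_Suc by metis
    moreover have "members (Suc k) e = members k e" using False by (simp add: members_def)
    moreover have "holds C (code (Split k e)) \<tau> \<longleftrightarrow> holds C (code (sub_node k e)) \<tau>"
      using holds_Or_code[OF all_nodes_intros(7)[OF k e]] False by (simp del: code.simps)
    ultimately show ?thesis using Suc.IH[of e] k e by (simp del: code.simps)
  qed
qed

lemma holds_Root: "holds C (code Root) \<tau> \<longleftrightarrow> (\<forall>h<m. good n \<tau> h)"
proof -
  have "holds C (code Root) \<tau> \<longleftrightarrow>
      (\<forall>f\<in>tops (cluster n) {..<m}. holds C (code (sub_node n f)) \<tau>)"
    using holds_And_code[OF all_nodes_intros(9)] holds_literals(5) by (simp del: code.simps)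
  also have "\<dots> \<longleftrightarrow> (\<forall>f\<in>tops (cluster n) {..<m}. \<forall>h. cluster n h f \<longrightarrow> good n \<tau> h)"
  proof (rule ball_cong)
    fix f assume "f \<in> tops (cluster n) {..<m}"
    then have "f < m" using tops_subset[of "cluster n" "{..<m}"] by blast
    then show "holds C (code (sub_node n f)) \<tau> \<longleftrightarrow> (\<forall>h. cluster n h f \<longrightarrow> good n \<tau> h)"
      using holds_sub_node[of n f] by (simp add: members_def)
  qed simp
  also have "\<dots> \<longleftrightarrow> (\<forall>h\<in>{..<m}. good n \<tau> h)"
  proof (rule tops_members)
    show "h \<in> {..<m}" if "f \<in> {..<m}" "cluster n h f" for h f
      using that cluster_bound by blast
  qed simp_all
  finally show ?thesis unfolding Ball_def lessThan_iff .
qed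

lemma deterministic_nodes:
  assumes d: "d \<in> all_nodes" "gate zs d = Or_gate"
  shows "deterministic C (code d)"
proof (rule deterministic_if_exclusive)
  show "gate_of C (code d) = Or_gate" using d gate_C by simp
  obtain k e where k: "k < n" and e: "e < m" and d_eq: "d = Split k e"
    using d by (cases rule: all_nodes_cases) simp_all
  have excl: "\<not> (holds C (code (Case1 k e)) \<tau> \<and> holds C (code (Case0 k e)) \<tau>)" for \<tau>
    using holds_And_code[OF all_nodes_intros(5)[OF k e], of \<tau>] holds_literals(3,4)[OF k]
      holds_And_code[OF all_nodes_intros(6)[OF k e], of \<tau>]
    by (auto simp del: code.simps)
  show "w = w'" if "w \<in> inputs C (code d)" "w' \<in> inputs C (code d)" "holds C w \<tau>" "holds C w' \<tau>" for w w' \<tau>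
    using that excl[of \<tau>] unfolding inputs_code[OF d(1)] unfolding d_eq inp.simps
    by (auto split: if_splits simp del: code.simps)
qed

lemma gate_leaf_or_inner:
  assumes "d \<in> all_nodes"
  shows "if inp d = {} then gate zs d \<in> {Zero, One} \<union> Pos ` set zs \<union> Neg ` set zs
         else gate zs d \<in> {And_gate, Or_gate}"
  using assms zs(2)
  by (cases rule: all_nodes_cases) (simp_all add: ord_bound trans_less_add1)

theorem d_DNNF_built: "d_DNNF (set zs) C"
proof -
  have "nnf_circuit (set zs) C"
    unfolding nnf_circuit_def
  proof (intro conjI ballI)
    show "wires C \<subseteq> nodes C \<times> nodes C" using wire_set_subset by (simp add: wires_C nodes_C)
    show "acyclic (wires C)" using wire_set_acyclic by (simp add: wires_C)
    show "out_node C \<in> nodes C" unfolding out_C by (rule code_in_nodes[OF all_nodes_intros(9)])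
    show "finite (nodes C)" by (simp add: nodes_C)
    fix v assume "v \<in> nodes C"
    then obtain d where "d \<in> all_nodes" "v = code d" using node_obtain by blast
    then show "if inputs C v = {} then gate_of C v \<in> {Zero, One} \<union> Pos ` set zs \<union> Neg ` set zs
         else gate_of C v \<in> {And_gate, Or_gate}"
      using gate_leaf_or_inner[of d] by (simp add: inputs_code gate_C split: if_splits)
  qed simp
  moreover have "decomposable C v" if "v \<in> nodes C" "gate_of C v = And_gate" for v
    using that node_obtain decomposable_nodes gate_C by metis
  moreover have "deterministic C v" if "v \<in> nodes C" "gate_of C v = Or_gate" for v
    using that node_obtain deterministic_nodes gate_C by metis
  ultimately show ?thesis by (simp add: d_DNNF_def)
qed

theorem computed_set_built:
  "computed_set (set zs) C =
    {\<tau> \<in> assignments (set zs). \<forall>h<m. \<tau> (zs ! (n + h)) \<longleftrightarrow> (\<forall>i<n. A h i \<longrightarrow> \<tau> (zs ! i))}"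
proof -
  have "(\<forall>i<n. I h i \<longrightarrow> \<tau> (zs ! ord i)) \<longleftrightarrow> (\<forall>i<n. A h i \<longrightarrow> \<tau> (zs ! i))" for h \<tau>
  proof -
    have "(\<forall>i\<in>{..<n}. I h i \<longrightarrow> \<tau> (zs ! ord i)) \<longleftrightarrow> (\<forall>i\<in>ord ` {..<n}. A h i \<longrightarrow> \<tau> (zs ! i))"
      by (simp add: I_def)
    also have "ord ` {..<n} = {..<n}" using gone_all by (simp add: gone_eq)
    finally show ?thesis by (simp add: Ball_def)
  qed
  then show ?thesis by (simp add: computed_set_holds out_C holds_Root good_def del: code.simps)
qed

theorem circuit_size_built: "circuit_size C \<le> (base n + 2) ^ 2"
proof -
  have "card (wires C) \<le> card ({..<base n + 2} \<times> {..<base n + 2})"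
    using wire_set_subset by (intro card_mono) (simp_all add: wires_C)
  then show ?thesis by (simp add: circuit_size_def power2_eq_square)
qed

end

section \<open>Programs with bounded loops\<close>

text \<open>
  While programs whose only loops are \<open>LFor x y p\<close>: the scalar \<open>x\<close> runs from 0 up to the value of the
  scalar \<open>y\<close>.
\<close>
datatype lp =
    LNop
  | LSet string aexp aexp
  | LSeq lp lp (infixr ";;" 60)
  | LIf bexp lp lp
  | LFor string string lp

definition step_var :: "string \<Rightarrow> state \<Rightarrow> state" where
  "step_var x s = s(x := (s x)(0 := Suc (s x 0)))"

primrec den :: "lp \<Rightarrow> state \<Rightarrow> state" where
  "den LNop s = s"
| "den (LSet x a b) s = s(x := (s x)(aval a s := aval b s))"
| "den (p ;; q) s = den q (den p s)"
| "den (LIf b p q) s = (if bval b s then den p s else den q s)"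
| "den (LFor x y p) s = ((step_var x \<circ> den p) ^^ s y 0) (s(x := (s x)(0 := 0)))"

abbreviation scal :: "string \<Rightarrow> aexp" where
  "scal x \<equiv> Cell x (Num 0)"

primrec compile :: "lp \<Rightarrow> com" where
  "compile LNop = Skip"
| "compile (LSet x a b) = Assign x a b"
| "compile (p ;; q) = Seq (compile p) (compile q)"
| "compile (LIf b p q) = If b (compile p) (compile q)"
| "compile (LFor x y p) = Seq (Assign x (Num 0) (Num 0))
     (While (Less (scal x) (scal y))
        (Seq (compile p) (Assign x (Num 0) (Plus (scal x) (Num 1)))))"

primrec writes :: "lp \<Rightarrow> string set" where
  "writes LNop = {}"
| "writes (LSet x a b) = {x}"
| "writes (p ;; q) = writes p \<union> writes q"
| "writes (LIf b p q) = writes p \<union> writes q"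
| "writes (LFor x y p) = insert x (writes p)"

text \<open>
  Loops are bounded by the scalars \<open>n\<close> and \<open>m\<close> of the input, which are never overwritten, and a body
  leaves its loop counter alone.  So the number of iterations is known in advance.
\<close>
primrec well_formed :: "lp \<Rightarrow> bool" where
  "well_formed LNop \<longleftrightarrow> True"
| "well_formed (LSet x a b) \<longleftrightarrow> x \<notin> {''n'', ''m''}"
| "well_formed (p ;; q) \<longleftrightarrow> well_formed p \<and> well_formed q"
| "well_formed (LIf b p q) \<longleftrightarrow> well_formed p \<and> well_formed q"
| "well_formed (LFor x y p) \<longleftrightarrow>
     x \<notin> {''n'', ''m''} \<and> y \<in> {''n'', ''m''} \<and> x \<notin> writes p \<and> well_formed p"

text \<open>
  A polynomial in the values of \<open>n\<close> and \<open>m\<close>.  The factor \<open>[:[:0, 1:], 1:]\<close> is their sum, which bounds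
  the number of iterations of every loop; an iteration costs two steps on top of its body, and so
  does the loop itself.
\<close>
primrec cost :: "lp \<Rightarrow> nat poly poly" where
  "cost LNop = 1"
| "cost (LSet x a b) = 1"
| "cost (p ;; q) = cost p + cost q"
| "cost (LIf b p q) = cost p + cost q + 1"
| "cost (LFor x y p) = [:[:0, 1:], 1:] * (cost p + 2) + 2"

lemma poly2_simps [simp]:
  "poly2 (p + q) x y = poly2 p x y + poly2 q x y"
  "poly2 (p * q) x y = poly2 p x y * poly2 q x y"
  "poly2 1 x y = 1" "poly2 (numeral w) x y = numeral w"
  "poly2 [:[:0, 1:]:] x y = y" "poly2 [:0, 1:] x y = x"
  "poly2 [:[:0, 1:], 1:] x y = x + y"
proof -
  have "poly (poly (numeral w) [:x:]) y = (numeral w :: nat)"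
    by (metis of_nat_numeral poly_of_nat of_nat_id)
  then show "poly2 (numeral w) x y = numeral w" by (simp add: poly2_def)
qed (simp_all add: poly2_def)

lemma poly2_power [simp]: "poly2 (p ^ k) x y = poly2 p x y ^ k"
  by (induction k) simp_all

lemma den_frame: "z \<notin> writes p \<Longrightarrow> den p s z = s z"
proof (induction p arbitrary: s)
  case (LFor x y p)
  have "((step_var x \<circ> den p) ^^ j) t z = t z" for j t
    using LFor by (induction j) (auto simp: step_var_def)
  then show ?case using LFor.prems by simp
qed auto

lemma well_formed_writes: "well_formed p \<Longrightarrow> ''n'' \<notin> writes p \<and> ''m'' \<notin> writes p"
  by (induction p) auto

lemma run_compile:
  "well_formed p \<Longrightarrow> s ''n'' 0 = n \<Longrightarrow> s ''m'' 0 = m \<Longrightarrow>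
    \<exists>t\<le>poly2 (cost p) n m. run (compile p) s t (den p s)"
proof (induction p arbitrary: s)
  case LNop
  have "run (compile LNop) s 1 (den LNop s)" by (simp only: compile.simps den.simps run.Skip)
  then show ?case by (intro exI[of _ 1]) (simp del: compile.simps den.simps)
next
  case (LSet x a b)
  have "run (compile (LSet x a b)) s 1 (den (LSet x a b) s)"
    by (simp only: compile.simps den.simps run.Assign)
  then show ?case by (intro exI[of _ 1]) (simp del: compile.simps den.simps)
next
  case (LSeq p q)
  from LSeq.IH(1)[of s] LSeq.prems obtain t where
    t: "t \<le> poly2 (cost p) n m" "run (compile p) s t (den p s)" by auto
  have "den p s ''n'' = s ''n''" "den p s ''m'' = s ''m''"
    using LSeq.prems well_formed_writes[of p] den_frame by auto
  with LSeq.IH(2)[of "den p s"] LSeq.prems obtain u where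
    u: "u \<le> poly2 (cost q) n m" "run (compile q) (den p s) u (den q (den p s))" by auto
  show ?case using run.Seq[OF t(2) u(2)] t(1) u(1) by (auto intro!: exI[of _ "t + u"])
next
  case (LIf b p q)
  show ?case
  proof (cases "bval b s")
    case True
    from LIf.IH(1)[of s] LIf.prems obtain t where
      t: "t \<le> poly2 (cost p) n m" "run (compile p) s t (den p s)" by auto
    show ?thesis using run.IfTrue[OF True t(2), of "compile q"] t(1) True
      by (auto intro!: exI[of _ "t + 1"])
  next
    case False
    from LIf.IH(2)[of s] LIf.prems obtain t where
      t: "t \<le> poly2 (cost q) n m" "run (compile q) s t (den q s)" by auto
    show ?thesis using run.IfFalse[OF False t(2), of "compile p"] t(1) False
      by (auto intro!: exI[of _ "t + 1"])
  qed
next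
  case (LFor x y p)
  let ?b = "Less (scal x) (scal y)"
  let ?c = "Seq (compile p) (Assign x (Num 0) (Plus (scal x) (Num 1)))"
  let ?f = "step_var x \<circ> den p"
  have y: "y = ''n'' \<or> y = ''m''" and x: "x \<noteq> ''n''" "x \<noteq> ''m''" "x \<notin> writes p" "well_formed p"
    using LFor.prems by auto
  have loop: "\<exists>u\<le>d * (poly2 (cost p) n m + 2) + 1. run (While ?b ?c) t u ((?f ^^ d) t)"
    if "t ''n'' 0 = n" "t ''m'' 0 = m" "t y 0 = t x 0 + d" for t d
    using that
  proof (induction d arbitrary: t)
    case 0
    then have "\<not> bval ?b t" by simp
    then show ?case using run.WhileFalse[of ?b t ?c] by auto
  next
    case (Suc d)
    from LFor.IH[of t] x Suc.prems obtain u where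
      u: "u \<le> poly2 (cost p) n m" "run (compile p) t u (den p t)" by auto
    have body: "run ?c t (u + 1) (?f t)"
      using run.Seq[OF u(2) run.Assign[of x "Num 0" "Plus (scal x) (Num 1)" "den p t"]]
      by (simp add: step_var_def)
    have "?f t ''n'' 0 = n" "?f t ''m'' 0 = m" "?f t y 0 = ?f t x 0 + d"
      using Suc.prems x y well_formed_writes[of p] by (auto simp: step_var_def den_frame)
    from Suc.IH[of "?f t", OF this] obtain v where
      v: "v \<le> d * (poly2 (cost p) n m + 2) + 1" "run (While ?b ?c) (?f t) v ((?f ^^ d) (?f t))"
      by blast
    have "bval ?b t" using Suc.prems by simp
    from run.WhileTrue[OF this body v(2)]
    have "run (While ?b ?c) t (u + 1 + v + 1) ((?f ^^ Suc d) t)"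
      by (simp add: funpow_swap1)
    moreover have "u + 1 + v + 1 \<le> Suc d * (poly2 (cost p) n m + 2) + 1"
      using u(1) v(1) by simp
    ultimately show ?case by blast
  qed
  define s0 where "s0 = s(x := (s x)(0 := 0))"
  have "s0 ''n'' 0 = n" "s0 ''m'' 0 = m" "s0 y 0 = s0 x 0 + s y 0"
    using LFor.prems x y by (auto simp: s0_def)
  from loop[of s0 "s y 0", OF this] obtain u where
    u: "u \<le> s y 0 * (poly2 (cost p) n m + 2) + 1" "run (While ?b ?c) s0 u ((?f ^^ s y 0) s0)"
    by blast
  have "run (compile (LFor x y p)) s (1 + u) (den (LFor x y p) s)"
    using run.Seq[OF run.Assign[of x "Num 0" "Num 0" s]] u(2) by (simp add: s0_def)
  moreover have "1 + u \<le> poly2 (cost (LFor x y p)) n m"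
  proof -
    have "s y 0 \<le> n + m" using y LFor.prems by auto
    then have "s y 0 * (poly2 (cost p) n m + 2) \<le> (n + m) * (poly2 (cost p) n m + 2)"
      by (rule mult_le_mono1)
    moreover have "poly2 (cost (LFor x y p)) n m = (n + m) * (poly2 (cost p) n m + 2) + 2"
      by (simp del: mult_pCons_left One_nat_def)
    ultimately show ?thesis using u(1) by simp
  qed
  ultimately show ?case by blast
qed

text \<open>
  Besides the invariant, the body may rely on everything that the loop does not write; this keeps
  invariants small.
\<close>
lemma for_invariant:
  assumes x: "x \<notin> writes p"
    and init: "Inv 0 (s(x := (s x)(0 := 0)))"
    and step: "\<And>i t. i < s y 0 \<Longrightarrow> Inv i t \<Longrightarrow> t x = (s x)(0 := i) \<Longrightarrow>
      (\<And>z. z \<notin> insert x (writes p) \<Longrightarrow> t z = s z) \<Longrightarrow> Inv (Suc i) (step_var x (den p t))"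
  shows "Inv (s y 0) (den (LFor x y p) s)"
proof -
  let ?f = "step_var x \<circ> den p"
  let ?s = "s(x := (s x)(0 := 0))"
  have "Inv i ((?f ^^ i) ?s) \<and> (?f ^^ i) ?s x = (s x)(0 := i) \<and>
      (\<forall>z. z \<notin> insert x (writes p) \<longrightarrow> (?f ^^ i) ?s z = s z)" if "i \<le> s y 0" for i
    using that
  proof (induction i)
    case 0
    have "?s x = (s x)(0 := 0)" "\<And>z. z \<noteq> x \<Longrightarrow> ?s z = s z" by simp_all
    then show ?case using init unfolding funpow_0 by blast
  next
    case (Suc i)
    define t where "t = (?f ^^ i) ?s"
    have t: "Inv i t" "t x = (s x)(0 := i)" "\<And>z. z \<notin> insert x (writes p) \<Longrightarrow> t z = s z"
      using Suc.IH[OF Suc_leD[OF Suc.prems]] unfolding t_def by blast+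
    have "(?f ^^ Suc i) ?s = step_var x (den p t)" by (simp add: t_def del: fun_upd_apply)
    moreover have "Inv (Suc i) (step_var x (den p t))" using step[of i t] t Suc.prems by simp
    moreover have "step_var x (den p t) x = (s x)(0 := Suc i)"
      using x t(2) by (simp add: step_var_def den_frame fun_eq_iff)
    moreover have "step_var x (den p t) z = s z" if "z \<notin> insert x (writes p)" for z
      using that t(3)[of z] by (simp add: step_var_def den_frame)
    ultimately show ?case by presburger
  qed
  then show ?thesis by simp
qed

lemma step_var_other [simp]: "z \<noteq> x \<Longrightarrow> step_var x s z = s z"
  by (simp add: step_var_def)

text \<open>
  A bounded universal quantifier: it leaves its truth value in the scalar \<open>c\<close>.
\<close>
definition ForAll :: "string \<Rightarrow> string \<Rightarrow> string \<Rightarrow> bexp \<Rightarrow> lp" where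
  "ForAll c x y b =
     LSet c (Num 0) (Num 1) ;; LFor x y (LIf b LNop (LSet c (Num 0) (Num 0)))"

lemma writes_ForAll [simp]: "writes (ForAll c x y b) = {c, x}"
  by (auto simp: ForAll_def)

lemma well_formed_ForAll [simp]:
  "well_formed (ForAll c x y b) \<longleftrightarrow>
    c \<notin> {''n'', ''m''} \<and> x \<notin> {''n'', ''m''} \<and> y \<in> {''n'', ''m''} \<and> x \<noteq> c"
  by (auto simp: ForAll_def)

lemma den_ForAll:
  assumes "x \<noteq> c" "y \<noteq> c" "y \<noteq> x" "s y 0 = K"
    and b: "\<And>t i. i < K \<Longrightarrow> t x 0 = i \<Longrightarrow> (\<And>z. z \<noteq> x \<Longrightarrow> z \<noteq> c \<Longrightarrow> t z = s z) \<Longrightarrow> bval b t \<longleftrightarrow> P i"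
  shows "den (ForAll c x y b) s c 0 = of_bool (\<forall>i<K. P i)"
proof -
  let ?p = "LIf b LNop (LSet c (Num 0) (Num 0))"
  let ?s = "s(c := (s c)(0 := 1))"
  have "den (LFor x y ?p) ?s c 0 = of_bool (\<forall>j<?s y 0. P j)"
  proof (rule for_invariant[where Inv = "\<lambda>i t. t c 0 = of_bool (\<forall>j<i. P j)"])
    fix i t
    assume i: "i < ?s y 0" and t: "t c 0 = of_bool (\<forall>j<i. P j)" "t x = (?s x)(0 := i)"
      "\<And>z. z \<notin> insert x (writes ?p) \<Longrightarrow> t z = ?s z"
    have "bval b t \<longleftrightarrow> P i" using b[of i t] i t assms by simp
    then show "step_var x (den ?p t) c 0 = of_bool (\<forall>j<Suc i. P j)"
      using t(1) assms(1) by (auto simp: less_Suc_eq)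
  qed (use assms in auto)
  then show ?thesis using assms by (simp add: ForAll_def)
qed

lemma row_major_eq:
  assumes "j < m" "j' < (m :: nat)"
  shows "i * m + j = i' * m + j' \<longleftrightarrow> i = i' \<and> j = j'"
proof
  assume eq: "i * m + j = i' * m + j'"
  have "i = (i * m + j) div m" "i' = (i' * m + j') div m" using assms by simp_all
  then show "i = i' \<and> j = j'" using eq by auto
qed simp

text \<open>
  Square matrices of order \<open>m\<close> are stored row by row, and no cell is written twice.
\<close>
lemma fill_matrix:
  assumes m: "s ''m'' 0 = m"
    and names: "x \<noteq> y" "x \<notin> writes p" "y \<notin> writes p" "a \<noteq> x" "a \<noteq> y"
      "''m'' \<notin> writes p" "x \<noteq> ''m''" "y \<noteq> ''m''"
    and body: "\<And>t i j. i < m \<Longrightarrow> j < m \<Longrightarrow> t x 0 = i \<Longrightarrow> t y 0 = j \<Longrightarrow>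
      (\<And>z. z \<notin> insert x (insert y (writes p)) \<Longrightarrow> t z = s z) \<Longrightarrow>
      den p t a = (t a)(i * m + j := F i j)"
  shows "\<forall>i<m. \<forall>j<m. den (LFor x ''m'' (LFor y ''m'' p)) s a (i * m + j) = F i j"
proof -
  let ?row = "LFor y ''m'' p"
  have "\<forall>i<s ''m'' 0. \<forall>j<m. den (LFor x ''m'' ?row) s a (i * m + j) = F i j"
  proof (rule for_invariant[where Inv = "\<lambda>k t. \<forall>i<k. \<forall>j<m. t a (i * m + j) = F i j"])
    fix k t
    assume k: "k < s ''m'' 0" and Inv: "\<forall>i<k. \<forall>j<m. t a (i * m + j) = F i j"
      and tx: "t x = (s x)(0 := k)"
      and frame: "\<And>z. z \<notin> insert x (writes ?row) \<Longrightarrow> t z = s z"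
    have tm: "t ''m'' 0 = m" using frame m names by simp
    have "(\<forall>i<k. \<forall>j<m. den ?row t a (i * m + j) = F i j) \<and>
        (\<forall>j<t ''m'' 0. den ?row t a (k * m + j) = F k j)"
    proof (rule for_invariant[where Inv = "\<lambda>l u. (\<forall>i<k. \<forall>j<m. u a (i * m + j) = F i j) \<and>
        (\<forall>j<l. u a (k * m + j) = F k j)"])
      fix l u
      assume l: "l < t ''m'' 0"
        and Inv': "(\<forall>i<k. \<forall>j<m. u a (i * m + j) = F i j) \<and> (\<forall>j<l. u a (k * m + j) = F k j)"
        and uy: "u y = (t y)(0 := l)"
        and frame': "\<And>z. z \<notin> insert y (writes p) \<Longrightarrow> u z = t z"
      have "den p u a = (u a)(k * m + l := F k l)"
        using k l m tm uy frame'[of x] tx names by (intro body) (auto simp: frame frame')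
      then show "(\<forall>i<k. \<forall>j<m. step_var y (den p u) a (i * m + j) = F i j) \<and>
          (\<forall>j<Suc l. step_var y (den p u) a (k * m + j) = F k j)"
        using Inv' names l tm by (auto simp: row_major_eq less_Suc_eq)
    qed (use Inv names in auto)
    then show "\<forall>i<Suc k. \<forall>j<m. step_var x (den ?row t) a (i * m + j) = F i j"
      using names tm by (auto simp: less_Suc_eq simp del: den.simps)
  qed (use names in auto)
  then show ?thesis using m by simp
qed

definition wire_pairs :: "state \<Rightarrow> (nat \<times> nat) set" where
  "wire_pairs s = (\<lambda>k. (s ''src'' k, s ''dst'' k)) ` {..<s ''wires'' 0}"

text \<open>
  Appends to the list of wires, which is all that \<open>wire_pairs\<close> depends on.
\<close>
definition AddWire :: "aexp \<Rightarrow> aexp \<Rightarrow> lp" where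
  "AddWire a b = LSet ''src'' (scal ''wires'') a ;; LSet ''dst'' (scal ''wires'') b ;;
     LSet ''wires'' (Num 0) (Plus (scal ''wires'') (Num 1))"

lemma writes_AddWire [simp]: "writes (AddWire a b) = {''src'', ''dst'', ''wires''}"
  by (auto simp: AddWire_def)

lemma well_formed_AddWire [simp]: "well_formed (AddWire a b)"
  by (simp add: AddWire_def)

lemma wire_pairs_cong:
  "s ''src'' = t ''src'' \<Longrightarrow> s ''dst'' = t ''dst'' \<Longrightarrow> s ''wires'' = t ''wires'' \<Longrightarrow>
    wire_pairs s = wire_pairs t"
  by (simp add: wire_pairs_def)

lemma wire_pairs_upd [simp]:
  "x \<notin> {''src'', ''dst'', ''wires''} \<Longrightarrow> wire_pairs (s(x := a)) = wire_pairs s"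
  by (rule wire_pairs_cong) auto

lemma wire_pairs_frame:
  "{''src'', ''dst'', ''wires''} \<inter> writes p = {} \<Longrightarrow> wire_pairs (den p s) = wire_pairs s"
  by (intro wire_pairs_cong den_frame) auto

lemma wire_pairs_AddWire:
  assumes "\<And>u. aval b (s(''src'' := u)) = aval b s"
  shows "wire_pairs (den (AddWire a b) s) = insert (aval a s, aval b s) (wire_pairs s)"
  using assms by (auto simp: AddWire_def wire_pairs_def lessThan_Suc image_iff)

lemma wire_pairs_for:
  assumes x: "x \<notin> writes p" "x \<notin> {''src'', ''dst'', ''wires''}" and K: "s y 0 = K"
    and body: "\<And>t i. i < K \<Longrightarrow> t x 0 = i \<Longrightarrow>
      (\<And>z. z \<notin> insert x (writes p) \<Longrightarrow> t z = s z) \<Longrightarrow>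
      wire_pairs (den p t) = wire_pairs t \<union> G i"
  shows "wire_pairs (den (LFor x y p) s) = wire_pairs s \<union> (\<Union>i<K. G i)"
proof -
  have "wire_pairs (den (LFor x y p) s) = wire_pairs s \<union> (\<Union>i<s y 0. G i)"
  proof (rule for_invariant[where Inv = "\<lambda>k t. wire_pairs t = wire_pairs s \<union> (\<Union>i<k. G i)", OF x(1)])
    show "wire_pairs (s(x := (s x)(0 := 0))) = wire_pairs s \<union> (\<Union>i<0. G i)"
    proof -
      have "wire_pairs (s(x := (s x)(0 := 0))) = wire_pairs s"
        by (rule wire_pairs_cong) (use x(2) in auto)
      then show ?thesis by simp
    qed
    fix i t
    assume i: "i < s y 0" and Inv: "wire_pairs t = wire_pairs s \<union> (\<Union>j<i. G j)"
      and t: "t x = (s x)(0 := i)" "\<And>z. z \<notin> insert x (writes p) \<Longrightarrow> t z = s z"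
    have "wire_pairs (step_var x (den p t)) = wire_pairs (den p t)"
      using x(2) by (intro wire_pairs_cong) auto
    also have "\<dots> = wire_pairs t \<union> G i" using i K t by (intro body) auto
    finally show "wire_pairs (step_var x (den p t)) = wire_pairs s \<union> (\<Union>j<Suc i. G j)"
      using Inv by (auto simp: lessThan_Suc)
  qed
  then show ?thesis using K by simp
qed

section \<open>The program that writes the circuit\<close>

text \<open>
  Loops are handled by invariants, never by unfolding their iteration.
\<close>
declare den.simps(5) [simp del]

definition nonzero :: "aexp \<Rightarrow> bexp" where
  "nonzero a = Less (Num 0) a"

definition incident_at :: "aexp \<Rightarrow> aexp \<Rightarrow> bexp" where
  "incident_at e i = nonzero (Cell ''inc'' (Plus (Cell ''r'' e) i))"

text \<open>
  Multiplication is not available, so the offsets \<open>e * n\<close> and \<open>e * m\<close> of the rows of the incidence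
  matrix and of square matrices are tabulated in \<open>r\<close> and \<open>q\<close>.
\<close>
definition entry :: "aexp \<Rightarrow> aexp \<Rightarrow> aexp" where
  "entry e f = Plus (Cell ''q'' e) f"

text \<open>
  Tabulates the row offsets, makes \<open>Q\<close> the identity matrix, which is \<open>cluster 0\<close>, and writes the
  literals of the edge variables.
\<close>
definition Prepare :: lp where
  "Prepare = LFor ''e'' ''m''
     (LSet ''r'' (scal ''e'') (scal ''a'') ;; LSet ''q'' (scal ''e'') (scal ''b'') ;;
      LSet ''Q'' (Plus (scal ''b'') (scal ''e'')) (Num 1) ;;
      LSet ''a'' (Num 0) (Plus (scal ''a'') (scal ''n'')) ;;
      LSet ''b'' (Num 0) (Plus (scal ''b'') (scal ''m'')) ;;
      LSet ''kind'' (scal ''e'') (Num 3) ;;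
      LSet ''arg'' (scal ''e'') (Plus (scal ''n'') (scal ''e'')) ;;
      LSet ''kind'' (Plus (scal ''m'') (scal ''e'')) (Num 4) ;;
      LSet ''arg'' (Plus (scal ''m'') (scal ''e'')) (Plus (scal ''n'') (scal ''e''))) ;;
   LSet ''nodes'' (Num 0) (Plus (scal ''m'') (scal ''m''))"

definition Traces :: lp where
  "Traces = LFor ''e'' ''m'' (LFor ''f'' ''m''
     (ForAll ''c'' ''i'' ''n''
        (Not (And (And (Not (nonzero (Cell ''gone'' (scal ''i''))))
                       (incident_at (scal ''e'') (scal ''i'')))
                  (Not (incident_at (scal ''f'') (scal ''i''))))) ;;
      LSet ''le'' (entry (scal ''e'') (scal ''f'')) (scal ''c'')))"

text \<open>
  Is \<open>v\<close> a nest point?  The matrix \<open>le\<close> holds the inclusions between the traces.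
\<close>
definition CheckNest :: lp where
  "CheckNest = LSet ''ok'' (Num 0) (Num 1) ;; LFor ''e'' ''m''
        (ForAll ''c'' ''f'' ''m''
           (Not (And (And (incident_at (scal ''e'') (scal ''v''))
                          (incident_at (scal ''f'') (scal ''v'')))
                     (And (Not (nonzero (Cell ''le'' (entry (scal ''e'') (scal ''f'')))))
                          (Not (nonzero (Cell ''le'' (entry (scal ''f'') (scal ''e'')))))))) ;;
         LIf (nonzero (scal ''c'')) LNop (LSet ''ok'' (Num 0) (Num 0)))"

definition Pick :: lp where
  "Pick = LSet ''x'' (Num 0) (Num 0) ;; LFor ''v'' ''n''
     (CheckNest ;;
      LIf (And (nonzero (scal ''ok'')) (Not (nonzero (Cell ''gone'' (scal ''v'')))))
        (LSet ''x'' (Num 0) (scal ''v'')) LNop)"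

text \<open>
  One step of the recursion for \<open>cluster\<close>, from \<open>Q\<close> to \<open>P\<close>; the eliminated vertex is \<open>x\<close>.  Both
  matrices have the larger edge as row index.
\<close>
definition Merge :: lp where
  "Merge = LFor ''e'' ''m'' (LFor ''h'' ''m''
     (ForAll ''c'' ''f'' ''m''
        (Not (And (incident_at (scal ''f'') (scal ''x''))
                  (And (nonzero (Cell ''le'' (entry (scal ''f'') (scal ''e''))))
                       (nonzero (Cell ''Q'' (entry (scal ''f'') (scal ''h''))))))) ;;
      LIf (incident_at (scal ''e'') (scal ''x''))
        (LSet ''P'' (entry (scal ''e'') (scal ''h'')) (Minus (Num 1) (scal ''c'')))
        (LSet ''P'' (entry (scal ''e'') (scal ''h'')) (Cell ''Q'' (entry (scal ''e'') (scal ''h''))))))"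

text \<open>
  Within a stage, the scalar \<open>nodes\<close> holds the first number of the stage, and \<open>prev\<close> the offset of
  the nodes of the previous stage.
\<close>
definition node_at :: "aexp \<Rightarrow> aexp" where
  "node_at a = Plus (scal ''nodes'') a"

definition case1_at :: "aexp \<Rightarrow> aexp" where
  "case1_at e = node_at (Plus (Num 2) e)"

definition case0_at :: "aexp \<Rightarrow> aexp" where
  "case0_at e = node_at (Plus (Num 2) (Plus (scal ''m'') e))"

definition split_at :: "aexp \<Rightarrow> aexp" where
  "split_at e = node_at (Plus (Num 2) (Plus (scal ''m'') (Plus (scal ''m'') e)))"

definition sub_at :: "aexp \<Rightarrow> aexp" where
  "sub_at e = Plus (scal ''prev'') e"

definition Gates :: lp where
  "Gates =
     LSet ''kind'' (scal ''nodes'') (Num 3) ;; LSet ''arg'' (scal ''nodes'') (scal ''x'') ;;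
     LSet ''kind'' (node_at (Num 1)) (Num 4) ;; LSet ''arg'' (node_at (Num 1)) (scal ''x'') ;;
     LFor ''e'' ''m''
       (LSet ''kind'' (case1_at (scal ''e'')) (Num 5) ;;
        LSet ''kind'' (case0_at (scal ''e'')) (Num 5) ;;
        LSet ''kind'' (split_at (scal ''e'')) (Num 6))"

text \<open>
  Is \<open>f\<close> a representative of a maximal cluster of \<open>{g. b}\<close>?
\<close>
definition TestTop :: "bexp \<Rightarrow> lp" where
  "TestTop b = ForAll ''c'' ''g'' ''m''
     (Not (And (And b (nonzero (Cell ''Q'' (entry (scal ''g'') (scal ''f'')))))
               (Not (And (nonzero (Cell ''Q'' (entry (scal ''f'') (scal ''g''))))
                         (Not (Less (scal ''g'') (scal ''f'')))))))"

definition Wires :: lp where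
  "Wires = LFor ''e'' ''m''
     ((AddWire (scal ''nodes'') (case1_at (scal ''e'')) ;;
      AddWire (node_at (Num 1)) (case0_at (scal ''e'')) ;;
      LIf (incident_at (scal ''e'') (scal ''x''))
        (AddWire (case1_at (scal ''e'')) (split_at (scal ''e'')) ;;
         AddWire (case0_at (scal ''e'')) (split_at (scal ''e'')))
        (AddWire (sub_at (scal ''e'')) (split_at (scal ''e'')))) ;;
      LFor ''f'' ''m'' (LIf (nonzero (Cell ''P'' (entry (scal ''e'') (scal ''f''))))
        (LIf (incident_at (scal ''f'') (scal ''x''))
           (AddWire (Plus (scal ''m'') (scal ''f'')) (case0_at (scal ''e'')))
           (TestTop (And (nonzero (Cell ''P'' (entry (scal ''e'') (scal ''g''))))
                         (Not (incident_at (scal ''g'') (scal ''x'')))) ;;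
            LIf (nonzero (scal ''c''))
              (AddWire (sub_at (scal ''f'')) (case0_at (scal ''e''))) LNop) ;;
         TestTop (nonzero (Cell ''P'' (entry (scal ''e'') (scal ''g'')))) ;;
         LIf (nonzero (scal ''c'')) (AddWire (sub_at (scal ''f'')) (case1_at (scal ''e''))) LNop)
        LNop))"

definition Advance :: lp where
  "Advance =
     LFor ''e'' ''m'' (LFor ''f'' ''m'' (LSet ''Q'' (entry (scal ''e'') (scal ''f''))
       (Cell ''P'' (entry (scal ''e'') (scal ''f''))))) ;;
     LSet ''gone'' (scal ''x'') (Num 1) ;;
     LSet ''prev'' (Num 0) (split_at (Num 0)) ;;
     LSet ''nodes'' (Num 0) (split_at (scal ''m''))"

definition Stage :: lp where
  "Stage = Traces ;; Pick ;; Merge ;; Gates ;; Wires ;; Advance"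

definition Finish :: lp where
  "Finish =
     LSet ''kind'' (scal ''nodes'') (Num 2) ;; LSet ''kind'' (node_at (Num 1)) (Num 5) ;;
     AddWire (scal ''nodes'') (node_at (Num 1)) ;;
     LFor ''f'' ''m'' (TestTop (Less (Num 0) (Num 1)) ;;
       LIf (nonzero (scal ''c'')) (AddWire (sub_at (scal ''f'')) (node_at (Num 1))) LNop) ;;
     LSet ''out'' (Num 0) (node_at (Num 1)) ;;
     LSet ''nodes'' (Num 0) (node_at (Num 2))"

definition Compiler :: lp where
  "Compiler = Prepare ;; LFor ''k'' ''n'' Stage ;; Finish"

lemmas expr_defs = nonzero_def incident_at_def entry_def node_at_def case1_at_def case0_at_def
  split_at_def sub_at_def

section \<open>Correctness of the program\<close>

lemma writes_TestTop [simp]: "writes (TestTop b) = {''c'', ''g''}"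
  by (simp add: TestTop_def)

lemma writes_CheckNest [simp]: "writes CheckNest = {''ok'', ''e'', ''c'', ''f''}"
  by (auto simp: CheckNest_def)

lemma writes_phases [simp]:
  "writes Traces = {''e'', ''f'', ''c'', ''i'', ''le''}"
  "writes Pick = {''x'', ''v'', ''ok'', ''e'', ''c'', ''f''}"
  "writes Merge = {''e'', ''h'', ''c'', ''f'', ''P''}"
  "writes Gates = {''kind'', ''arg'', ''e''}"
  "writes Wires = {''e'', ''f'', ''c'', ''g'', ''src'', ''dst'', ''wires''}"
  "writes Advance = {''e'', ''f'', ''Q'', ''gone'', ''prev'', ''nodes''}"
  by (auto simp: Traces_def Pick_def Merge_def Gates_def Wires_def Advance_def)

lemma well_formed_Compiler: "well_formed Compiler"
  by (simp add: Compiler_def Prepare_def Stage_def Finish_def Traces_def Pick_def CheckNest_def Merge_def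
      Gates_def Wires_def Advance_def TestTop_def)

context incidence
begin

text \<open>
  What the program reads but does not change after the preparation.
\<close>
definition env :: "state \<Rightarrow> bool" where
  "env s \<longleftrightarrow> s ''n'' 0 = n \<and> s ''m'' 0 = m \<and> (\<forall>e<m. s ''r'' e = e * n \<and> s ''q'' e = e * m) \<and>
     (\<forall>e<m. \<forall>i<n. s ''inc'' (e * n + i) = of_bool (A e i))"

lemma envD:
  assumes "env s"
  shows "s ''n'' 0 = n" "s ''m'' 0 = m" "e < m \<Longrightarrow> s ''r'' e = e * n" "e < m \<Longrightarrow> s ''q'' e = e * m"
    "e < m \<Longrightarrow> i < n \<Longrightarrow> s ''inc'' (e * n + i) = of_bool (A e i)"
  using assms by (auto simp: env_def)

lemma env_cong: "env s \<Longrightarrow> (\<And>z. z \<in> {''n'', ''m'', ''r'', ''q'', ''inc''} \<Longrightarrow> t z = s z) \<Longrightarrow> env t"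
  by (simp add: env_def)

definition matrix :: "string \<Rightarrow> (nat \<Rightarrow> nat \<Rightarrow> bool) \<Rightarrow> state \<Rightarrow> bool" where
  "matrix a F s \<longleftrightarrow> (\<forall>e<m. \<forall>f<m. s a (e * m + f) = of_bool (F e f))"

lemma matrixD: "matrix a F s \<Longrightarrow> e < m \<Longrightarrow> f < m \<Longrightarrow> s a (e * m + f) = of_bool (F e f)"
  by (simp add: matrix_def)

definition removed :: "nat set \<Rightarrow> state \<Rightarrow> bool" where
  "removed W s \<longleftrightarrow> (\<forall>i<n. s ''gone'' i = of_bool (i \<in> W))"

lemma removedD: "removed W s \<Longrightarrow> i < n \<Longrightarrow> s ''gone'' i = of_bool (i \<in> W)"
  by (simp add: removed_def)

lemma Traces_correct:
  assumes s: "env s" "removed W s"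
  shows "matrix ''le'' (trace_le W) (den Traces s)"
  unfolding matrix_def Traces_def
proof (rule fill_matrix)
  let ?b = "Not (And (And (Not (nonzero (Cell ''gone'' (scal ''i''))))
                       (incident_at (scal ''e'') (scal ''i'')))
                  (Not (incident_at (scal ''f'') (scal ''i''))))"
  let ?p = "ForAll ''c'' ''i'' ''n'' ?b ;; LSet ''le'' (entry (scal ''e'') (scal ''f'')) (scal ''c'')"
  fix t :: state and e f
  assume ef: "e < m" "f < m" "t ''e'' 0 = e" "t ''f'' 0 = f"
    and t: "\<And>z. z \<notin> insert ''e'' (insert ''f'' (writes ?p)) \<Longrightarrow> t z = s z"
  have "den (ForAll ''c'' ''i'' ''n'' ?b) t ''c'' 0 =
      of_bool (\<forall>i<n. i \<notin> W \<longrightarrow> A e i \<longrightarrow> A f i)"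
  proof (rule den_ForAll)
    fix u :: state and i
    assume "i < n" "u ''i'' 0 = i" "\<And>z. z \<noteq> ''i'' \<Longrightarrow> z \<noteq> ''c'' \<Longrightarrow> u z = t z"
    then show "bval ?b u \<longleftrightarrow> (i \<notin> W \<longrightarrow> A e i \<longrightarrow> A f i)"
      using ef t envD[OF s(1)] removedD[OF s(2)] by (simp add: expr_defs) blast
  qed (use t envD[OF s(1)] in simp_all)
  then show "den ?p t ''le'' = (t ''le'')(e * m + f := of_bool (trace_le W e f))"
    using ef t envD[OF s(1)] by (simp add: trace_le_def den_frame expr_defs)
qed (use envD[OF s(1)] in simp_all)


lemma CheckNest_correct:
  assumes s: "env s" "matrix ''le'' (trace_le W) s" and v: "s ''v'' 0 = v" "v < n"
  shows "den CheckNest s ''ok'' 0 =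
    of_bool (\<forall>e<m. \<forall>f<m. A e v \<longrightarrow> A f v \<longrightarrow> trace_le W e f \<or> trace_le W f e)"
proof -
  let ?b = "Not (And (And (incident_at (scal ''e'') (scal ''v''))
                          (incident_at (scal ''f'') (scal ''v'')))
                     (And (Not (nonzero (Cell ''le'' (entry (scal ''e'') (scal ''f'')))))
                          (Not (nonzero (Cell ''le'' (entry (scal ''f'') (scal ''e'')))))))"
  let ?p = "ForAll ''c'' ''f'' ''m'' ?b ;;
     LIf (nonzero (scal ''c'')) LNop (LSet ''ok'' (Num 0) (Num 0))"
  let ?P = "\<lambda>e. \<forall>f<m. A e v \<longrightarrow> A f v \<longrightarrow> trace_le W e f \<or> trace_le W f e"
  let ?s = "den (LSet ''ok'' (Num 0) (Num 1)) s"
  have sm: "?s ''m'' 0 = m" using envD[OF s(1)] by simp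
  have "den (LFor ''e'' ''m'' ?p) ?s ''ok'' 0 = of_bool (\<forall>e<?s ''m'' 0. ?P e)"
  proof (rule for_invariant[where Inv = "\<lambda>k t. t ''ok'' 0 = of_bool (\<forall>e<k. ?P e)"])
    fix e t
    assume e: "e < ?s ''m'' 0" "t ''e'' = (?s ''e'')(0 := e)"
      and Inv: "t ''ok'' 0 = of_bool (\<forall>j<e. ?P j)"
      and t: "\<And>z. z \<notin> insert ''e'' (writes ?p) \<Longrightarrow> t z = ?s z"
    define w where "w = den (ForAll ''c'' ''f'' ''m'' ?b) t"
    have "w ''c'' 0 = of_bool (?P e)"
      unfolding w_def
    proof (rule den_ForAll)
      fix u :: state and f
      assume "f < m" "u ''f'' 0 = f" "\<And>z. z \<noteq> ''f'' \<Longrightarrow> z \<noteq> ''c'' \<Longrightarrow> u z = t z"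
      then show "bval ?b u \<longleftrightarrow> (A e v \<longrightarrow> A f v \<longrightarrow> trace_le W e f \<or> trace_le W f e)"
        using e t sm v envD[OF s(1)] matrixD[OF s(2)] by (simp add: expr_defs) blast
    qed (use t sm in simp_all)
    moreover have "w ''ok'' = t ''ok''" by (simp add: w_def den_frame)
    ultimately show "step_var ''e'' (den ?p t) ''ok'' 0 = of_bool (\<forall>j<Suc e. ?P j)"
      using Inv unfolding den.simps w_def[symmetric] by (auto simp: nonzero_def less_Suc_eq)
  qed simp_all
  then show ?thesis using sm by (simp add: CheckNest_def)
qed

lemma Pick_correct:
  assumes s: "env s" "removed W s" "matrix ''le'' (trace_le W) s"
  shows "den Pick s ''x'' 0 = last_nest W n"
proof -
  let ?c = "LIf (And (nonzero (scal ''ok'')) (Not (nonzero (Cell ''gone'' (scal ''v'')))))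
        (LSet ''x'' (Num 0) (scal ''v'')) LNop"
  let ?p = "CheckNest ;; ?c"
  let ?s = "den (LSet ''x'' (Num 0) (Num 0)) s"
  have sn: "?s ''n'' 0 = n" using envD(1)[OF s(1)] by simp
  have "den (LFor ''v'' ''n'' ?p) ?s ''x'' 0 = last_nest W (?s ''n'' 0)"
  proof (rule for_invariant[where Inv = "\<lambda>k t. t ''x'' 0 = last_nest W k"])
    fix v t
    assume v: "v < ?s ''n'' 0" "t ''v'' = (?s ''v'')(0 := v)"
      and Inv: "t ''x'' 0 = last_nest W v"
      and t: "\<And>z. z \<notin> insert ''v'' (writes ?p) \<Longrightarrow> t z = ?s z"
    have t': "t z = s z" if "z \<notin> {''x'', ''v'', ''ok'', ''e'', ''c'', ''f''}" for z
      using t[of z] that by simp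
    have "env t" by (rule env_cong[OF s(1)], rule t') auto
    moreover have "matrix ''le'' (trace_le W) t" using s(3) by (simp add: matrix_def t')
    moreover have rem: "removed W t" using s(2) by (simp add: removed_def t')
    moreover define N where
      "N \<longleftrightarrow> (\<forall>e<m. \<forall>f<m. A e v \<longrightarrow> A f v \<longrightarrow> trace_le W e f \<or> trace_le W f e)"
    ultimately have "den CheckNest t ''ok'' 0 = of_bool N"
      using CheckNest_correct[of t W v] v sn by simp
    moreover have "nest W v \<longleftrightarrow> v \<notin> W \<and> N" by (simp add: nest_def N_def)
    ultimately show "step_var ''v'' (den ?p t) ''x'' 0 = last_nest W (Suc v)"
      using removedD[OF rem, of v] v sn Inv by (simp add: den_frame expr_defs)
  qed simp_all
  then show ?thesis using sn by (simp add: Pick_def)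
qed

lemma Merge_correct:
  assumes s: "env s" "matrix ''le'' (trace_le (gone k)) s" "matrix ''Q'' (\<lambda>e h. cluster k h e) s"
    and x: "s ''x'' 0 = ord k" "ord k < n"
  shows "matrix ''P'' (\<lambda>e h. cluster (Suc k) h e) (den Merge s)"
  unfolding matrix_def Merge_def
proof (rule fill_matrix)
  let ?b = "Not (And (incident_at (scal ''f'') (scal ''x''))
                  (And (nonzero (Cell ''le'' (entry (scal ''f'') (scal ''e''))))
                       (nonzero (Cell ''Q'' (entry (scal ''f'') (scal ''h''))))))"
  let ?q = "LIf (incident_at (scal ''e'') (scal ''x''))
        (LSet ''P'' (entry (scal ''e'') (scal ''h'')) (Minus (Num 1) (scal ''c'')))
        (LSet ''P'' (entry (scal ''e'') (scal ''h'')) (Cell ''Q'' (entry (scal ''e'') (scal ''h''))))"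
  let ?p = "ForAll ''c'' ''f'' ''m'' ?b ;; ?q"
  fix t :: state and e h
  assume eh: "e < m" "h < m" "t ''e'' 0 = e" "t ''h'' 0 = h"
    and t: "\<And>z. z \<notin> insert ''e'' (insert ''h'' (writes ?p)) \<Longrightarrow> t z = s z"
  define w where "w = den (ForAll ''c'' ''f'' ''m'' ?b) t"
  have "w ''c'' 0 = of_bool (\<forall>f<m. \<not> (I f k \<and> trace_le (gone k) f e \<and> cluster k h f))"
    unfolding w_def
  proof (rule den_ForAll)
    fix u :: state and f
    assume "f < m" "u ''f'' 0 = f" "\<And>z. z \<noteq> ''f'' \<Longrightarrow> z \<noteq> ''c'' \<Longrightarrow> u z = t z"
    then show "bval ?b u \<longleftrightarrow> \<not> (I f k \<and> trace_le (gone k) f e \<and> cluster k h f)"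
      using eh t x envD[OF s(1)] matrixD[OF s(2)] matrixD[OF s(3)]
      by (simp add: expr_defs I_def)
  qed (use t envD[OF s(1)] in simp_all)
  moreover define N where "N \<longleftrightarrow> (\<exists>f<m. I f k \<and> trace_le (gone k) f e \<and> cluster k h f)"
  ultimately have "w ''c'' 0 = of_bool (\<not> N)" by auto
  moreover have "cluster (Suc k) h e \<longleftrightarrow> (if A e (ord k) then N else cluster k h e)"
    by (simp add: N_def I_def)
  moreover have "w z = t z" if "z \<notin> {''c'', ''f''}" for z
    using that by (simp add: w_def den_frame)
  ultimately show "den ?p t ''P'' = (t ''P'')(e * m + h := of_bool (cluster (Suc k) h e))"
    unfolding den.simps(3) w_def[symmetric]
    using eh t x envD[OF s(1)] matrixD[OF s(3)]
    by (simp add: expr_defs del: cluster.simps)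
qed (use envD[OF s(1)] in simp_all)

primrec kind_of :: "node \<Rightarrow> nat" where
  "kind_of (Ypos j) = 3"
| "kind_of (Yneg j) = 4"
| "kind_of (Xpos k) = 3"
| "kind_of (Xneg k) = 4"
| "kind_of (Case1 k e) = 5"
| "kind_of (Case0 k e) = 5"
| "kind_of (Split k e) = 6"
| "kind_of Triv = 2"
| "kind_of Root = 5"

text \<open>
  Only literals have an argument; the other values are never compared with the memory.
\<close>
primrec arg_of :: "node \<Rightarrow> nat" where
  "arg_of (Ypos j) = n + j"
| "arg_of (Yneg j) = n + j"
| "arg_of (Xpos k) = ord k"
| "arg_of (Xneg k) = ord k"
| "arg_of (Case1 k e) = 0"
| "arg_of (Case0 k e) = 0"
| "arg_of (Split k e) = 0"
| "arg_of Triv = 0"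
| "arg_of Root = 0"

definition gates_written :: "node set \<Rightarrow> state \<Rightarrow> bool" where
  "gates_written D s \<longleftrightarrow> (\<forall>d\<in>D. s ''kind'' (code d) = kind_of d \<and>
     (kind_of d \<in> {3, 4} \<longrightarrow> s ''arg'' (code d) = arg_of d))"

lemma gates_written_Un:
  "gates_written (D \<union> D') s \<longleftrightarrow> gates_written D s \<and> gates_written D' s"
  by (auto simp: gates_written_def)

lemma gates_written_cong:
  "gates_written D s \<Longrightarrow> (\<And>d. d \<in> D \<Longrightarrow> t ''kind'' (code d) = s ''kind'' (code d)) \<Longrightarrow>
    (\<And>d. d \<in> D \<Longrightarrow> t ''arg'' (code d) = s ''arg'' (code d)) \<Longrightarrow> gates_written D t"
  by (simp add: gates_written_def)

lemma Gates_correct: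
  assumes s: "env s" "s ''nodes'' 0 = base k" "s ''x'' 0 = ord k"
  shows "gates_written (stage_nodes k) (den Gates s)"
    and "c < base k \<Longrightarrow> den Gates s ''kind'' c = s ''kind'' c"
    and "c < base k \<Longrightarrow> den Gates s ''arg'' c = s ''arg'' c"
proof -
  let ?pre = "LSet ''kind'' (scal ''nodes'') (Num 3) ;; LSet ''arg'' (scal ''nodes'') (scal ''x'') ;;
     LSet ''kind'' (node_at (Num 1)) (Num 4) ;; LSet ''arg'' (node_at (Num 1)) (scal ''x'')"
  let ?p = "LSet ''kind'' (case1_at (scal ''e'')) (Num 5) ;;
        LSet ''kind'' (case0_at (scal ''e'')) (Num 5) ;;
        LSet ''kind'' (split_at (scal ''e'')) (Num 6)"
  define s1 where "s1 = den ?pre s"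
  have s1: "s1 ''m'' 0 = m" "s1 ''nodes'' 0 = base k"
    "s1 ''kind'' = (s ''kind'')(base k := 3, base k + 1 := 4)"
    "s1 ''arg'' = (s ''arg'')(base k := ord k, base k + 1 := ord k)"
    using s envD[OF s(1)] by (simp_all add: s1_def expr_defs)
  let ?Inv = "\<lambda>j t. (\<forall>i<j. t ''kind'' (base k + 2 + i) = 5 \<and> t ''kind'' (base k + 2 + m + i) = 5 \<and>
      t ''kind'' (base k + 2 + 2 * m + i) = 6) \<and> (\<forall>c<base k + 2. t ''kind'' c = s1 ''kind'' c)"
  have "?Inv (s1 ''m'' 0) (den (LFor ''e'' ''m'' ?p) s1)"
  proof (rule for_invariant[where Inv = ?Inv])
    fix j t
    assume j: "j < s1 ''m'' 0" "t ''e'' = (s1 ''e'')(0 := j)" and Inv: "?Inv j t"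
      and t: "\<And>z. z \<notin> insert ''e'' (writes ?p) \<Longrightarrow> t z = s1 z"
    have "den ?p t ''kind'' = (t ''kind'')(base k + 2 + j := 5, base k + 2 + m + j := 5,
        base k + 2 + 2 * m + j := 6)"
      using j t s1 by (simp add: expr_defs add.assoc mult_2)
    then show "?Inv (Suc j) (step_var ''e'' (den ?p t))"
      using Inv j(1) s1(1) by (auto simp: less_Suc_eq)
  qed simp_all
  moreover have "den Gates s = den (LFor ''e'' ''m'' ?p) s1"
    by (simp add: Gates_def s1_def)
  ultimately have Inv: "?Inv m (den Gates s)" using s1(1) by simp
  have arg: "den Gates s ''arg'' = s1 ''arg''"
    using \<open>den Gates s = _\<close> by (simp add: den_frame)
  have low: "den Gates s ''kind'' c = s1 ''kind'' c" if "c < base k + 2" for c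
    using Inv that by blast
  have high: "den Gates s ''kind'' (base k + 2 + i) = 5"
    "den Gates s ''kind'' (base k + 2 + m + i) = 5"
    "den Gates s ''kind'' (base k + 2 + 2 * m + i) = 6" if "i < m" for i
    using Inv that by blast+
  show "gates_written (stage_nodes k) (den Gates s)"
    unfolding gates_written_def
  proof
    fix d assume "d \<in> stage_nodes k"
    then consider "d = Xpos k" | "d = Xneg k" | e where "e < m" "d = Case1 k e"
      | e where "e < m" "d = Case0 k e" | e where "e < m" "d = Split k e"
      by (auto simp: stage_nodes_def)
    then show "den Gates s ''kind'' (code d) = kind_of d \<and>
        (kind_of d \<in> {3, 4} \<longrightarrow> den Gates s ''arg'' (code d) = arg_of d)"
      by cases (simp_all add: low high arg s1(3,4) del: One_nat_def add_2_eq_Suc' add_Suc_right)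
  qed
  show "c < base k \<Longrightarrow> den Gates s ''kind'' c = s ''kind'' c"
    using low[of c] by (simp add: s1(3))
  show "c < base k \<Longrightarrow> den Gates s ''arg'' c = s ''arg'' c"
    by (simp add: arg s1(4))
qed


definition prev :: "nat \<Rightarrow> nat" where
  "prev k = code (sub_node k 0)"

lemma code_sub_node: "code (sub_node k e) = prev k + e"
  by (cases k) (simp_all add: prev_def)

lemma TestTop_correct:
  assumes s: "env s" "matrix ''Q'' (\<lambda>e h. cluster k h e) s"
    and f: "s ''f'' 0 = f" "f < m" "f \<in> D" and D: "D \<subseteq> {..<m}"
    and b: "\<And>u g. g < m \<Longrightarrow> u ''g'' 0 = g \<Longrightarrow> (\<And>z. z \<noteq> ''g'' \<Longrightarrow> z \<noteq> ''c'' \<Longrightarrow> u z = s z) \<Longrightarrow>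
      bval b u \<longleftrightarrow> g \<in> D"
  shows "den (TestTop b) s ''c'' 0 = of_bool (f \<in> tops (cluster k) D)"
proof -
  let ?b = "Not (And (And b (nonzero (Cell ''Q'' (entry (scal ''g'') (scal ''f'')))))
               (Not (And (nonzero (Cell ''Q'' (entry (scal ''f'') (scal ''g''))))
                         (Not (Less (scal ''g'') (scal ''f''))))))"
  let ?P = "\<lambda>g. \<not> (g \<in> D \<and> cluster k f g \<and> \<not> (cluster k g f \<and> f \<le> g))"
  have "den (TestTop b) s ''c'' 0 = of_bool (\<forall>g<m. ?P g)"
    unfolding TestTop_def
  proof (rule den_ForAll)
    fix u :: state and g
    assume "g < m" "u ''g'' 0 = g" and u: "\<And>z. z \<noteq> ''g'' \<Longrightarrow> z \<noteq> ''c'' \<Longrightarrow> u z = s z"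
    then show "bval ?b u \<longleftrightarrow> ?P g"
      using f envD[OF s(1)] matrixD[OF s(2)] b[of g u] by (simp add: expr_defs not_less)
  qed (use envD[OF s(1)] in simp_all)
  moreover have "(\<forall>g<m. ?P g) \<longleftrightarrow> f \<in> tops (cluster k) D"
    using f D by (auto simp: tops_def)
  ultimately show ?thesis by simp
qed

text \<open>
  What the innermost loop of \<open>Wires\<close> adds for one pair of edges; \<open>own_wires\<close> below is what comes
  before that loop.
\<close>
definition child_wires :: "nat \<Rightarrow> nat \<Rightarrow> nat \<Rightarrow> (nat \<times> nat) set" where
  "child_wires k e f =
     (if f \<in> members (Suc k) e then
        (if I f k then {(m + f, code (Case0 k e))}
         else if f \<in> tops (cluster k) {h \<in> members (Suc k) e. \<not> I h k}
           then {(prev k + f, code (Case0 k e))} else {}) \<union>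
        (if f \<in> tops (cluster k) (members (Suc k) e) then {(prev k + f, code (Case1 k e))} else {})
      else {})"

definition own_wires :: "nat \<Rightarrow> nat \<Rightarrow> (nat \<times> nat) set" where
  "own_wires k e =
     {(code (Xpos k), code (Case1 k e)), (code (Xneg k), code (Case0 k e))} \<union>
     (if I e k then {(code (Case1 k e), code (Split k e)), (code (Case0 k e), code (Split k e))}
      else {(prev k + e, code (Split k e))})"

lemma wire_set_Un: "wire_set (D \<union> D') = wire_set D \<union> wire_set D'"
  by (auto simp: wire_set_def)

lemma wire_set_block:
  assumes e: "e < m"
  shows "wire_set {Case1 k e, Case0 k e, Split k e} = own_wires k e \<union> (\<Union>f<m. child_wires k e f)"
proof -
  let ?M = "members (Suc k) e"
  let ?N = "{h \<in> members (Suc k) e. \<not> I h k}"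
  have M: "?M \<subseteq> {..<m}" by (rule members_bound[OF e])
  have T: "tops (cluster k) ?M \<subseteq> ?M" "tops (cluster k) ?N \<subseteq> ?N" by (rule tops_subset)+
  have "(\<Union>f<m. child_wires k e f) =
      (\<lambda>f. (m + f, code (Case0 k e))) ` {h \<in> ?M. I h k} \<union>
      (\<lambda>f. (prev k + f, code (Case0 k e))) ` tops (cluster k) ?N \<union>
      (\<lambda>f. (prev k + f, code (Case1 k e))) ` tops (cluster k) ?M" (is "?L = ?R")
  proof
    show "?L \<subseteq> ?R" by (auto simp: child_wires_def simp del: code.simps split: if_splits)
    show "?R \<subseteq> ?L"
    proof -
      have "(m + f, code (Case0 k e)) \<in> ?L" if "f \<in> ?M" "I f k" for f
        using that M by (auto simp: child_wires_def simp del: code.simps intro!: bexI[of _ f])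
      moreover have "(prev k + f, code (Case0 k e)) \<in> ?L" if "f \<in> tops (cluster k) ?N" for f
        using that M T(2) by (auto simp: child_wires_def simp del: code.simps intro!: bexI[of _ f])
      moreover have "(prev k + f, code (Case1 k e)) \<in> ?L" if "f \<in> tops (cluster k) ?M" for f
        using that M T(1) by (auto simp: child_wires_def simp del: code.simps intro!: bexI[of _ f])
      ultimately show ?thesis by blast
    qed
  qed
  moreover have "wire_set {Case1 k e, Case0 k e, Split k e} =
      (\<lambda>u. (code u, code (Case1 k e))) ` inp (Case1 k e) \<union>
      ((\<lambda>u. (code u, code (Case0 k e))) ` inp (Case0 k e) \<union>
       (\<lambda>u. (code u, code (Split k e))) ` inp (Split k e))"
    unfolding wire_set_def by blast
  moreover have "(\<lambda>u. (code u, code (Case1 k e))) ` inp (Case1 k e) =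
      insert (code (Xpos k), code (Case1 k e))
        ((\<lambda>f. (prev k + f, code (Case1 k e))) ` tops (cluster k) ?M)"
    by (simp add: image_image code_sub_node del: code.simps)
  moreover have "(\<lambda>u. (code u, code (Case0 k e))) ` inp (Case0 k e) =
      insert (code (Xneg k), code (Case0 k e))
        ((\<lambda>f. (m + f, code (Case0 k e))) ` {h \<in> ?M. I h k} \<union>
         (\<lambda>f. (prev k + f, code (Case0 k e))) ` tops (cluster k) ?N)"
    by (simp add: image_Un image_image code_sub_node del: code.simps(3-))
  moreover have "(\<lambda>u. (code u, code (Split k e))) ` inp (Split k e) =
     (if I e k then {(code (Case1 k e), code (Split k e)), (code (Case0 k e), code (Split k e))}
      else {(prev k + e, code (Split k e))})"
    by (simp add: code_sub_node del: code.simps)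
  moreover have "insert a X \<union> (insert b (Y \<union> Z) \<union> S) = ({a, b} \<union> S) \<union> (Y \<union> Z \<union> X)"
    for a b :: "nat \<times> nat" and X Y Z S by blast
  ultimately show ?thesis unfolding own_wires_def by (simp only:)
qed

lemma wire_set_stage:
  "wire_set (stage_nodes k) = (\<Union>e<m. wire_set {Case1 k e, Case0 k e, Split k e})"
  by (auto simp: wire_set_def stage_nodes_def simp del: code.simps)

lemma Wires_correct:
  assumes s: "env s" "matrix ''Q'' (\<lambda>e h. cluster k h e) s"
    "matrix ''P'' (\<lambda>e h. cluster (Suc k) h e) s"
    and vals: "s ''x'' 0 = ord k" "ord k < n" "s ''nodes'' 0 = base k" "s ''prev'' 0 = prev k"
  shows "wire_pairs (den Wires s) = wire_pairs s \<union> wire_set (stage_nodes k)"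
proof -
  let ?own = "AddWire (scal ''nodes'') (case1_at (scal ''e'')) ;;
      AddWire (node_at (Num 1)) (case0_at (scal ''e'')) ;;
      LIf (incident_at (scal ''e'') (scal ''x''))
        (AddWire (case1_at (scal ''e'')) (split_at (scal ''e'')) ;;
         AddWire (case0_at (scal ''e'')) (split_at (scal ''e'')))
        (AddWire (sub_at (scal ''e'')) (split_at (scal ''e'')))"
  let ?t0 = "TestTop (And (nonzero (Cell ''P'' (entry (scal ''e'') (scal ''g''))))
                         (Not (incident_at (scal ''g'') (scal ''x''))))"
  let ?t1 = "TestTop (nonzero (Cell ''P'' (entry (scal ''e'') (scal ''g''))))"
  let ?i0 = "LIf (nonzero (scal ''c'')) (AddWire (sub_at (scal ''f'')) (case0_at (scal ''e''))) LNop"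
  let ?i1 = "LIf (nonzero (scal ''c'')) (AddWire (sub_at (scal ''f'')) (case1_at (scal ''e''))) LNop"
  let ?q0 = "LIf (incident_at (scal ''f'') (scal ''x''))
           (AddWire (Plus (scal ''m'') (scal ''f'')) (case0_at (scal ''e'')))
           (?t0 ;; ?i0)"
  let ?p = "LIf (nonzero (Cell ''P'' (entry (scal ''e'') (scal ''f'')))) (?q0 ;; ?t1 ;; ?i1) LNop"
  let ?loop = "LFor ''f'' ''m'' ?p"
  have "wire_pairs (den (LFor ''e'' ''m'' (?own ;; ?loop)) s) =
      wire_pairs s \<union> (\<Union>e<m. own_wires k e \<union> (\<Union>f<m. child_wires k e f))"
  proof (rule wire_pairs_for)
    fix t :: state and e
    assume e: "e < m" "t ''e'' 0 = e"
      and frame: "\<And>z. z \<notin> insert ''e'' (writes (?own ;; ?loop)) \<Longrightarrow> t z = s z"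
    have t: "t z = s z" if "z \<notin> {''e'', ''f'', ''c'', ''g'', ''src'', ''dst'', ''wires''}" for z
      by (rule frame) (use that in simp)
    have vals_t: "t ''x'' 0 = ord k" "t ''nodes'' 0 = base k" "t ''prev'' 0 = prev k"
      "t ''m'' 0 = m" "t ''inc'' (t ''r'' e + ord k) = of_bool (I e k)"
      using vals envD[OF s(1)] e(1) by (simp_all add: t I_def)
    have "wire_pairs (den ?own t) = wire_pairs t \<union> own_wires k e"
      using e(2) vals_t
      by (simp add: wire_pairs_AddWire den_frame expr_defs own_wires_def add.assoc mult_2 insert_commute)
    moreover have "wire_pairs (den ?loop (den ?own t)) =
        wire_pairs (den ?own t) \<union> (\<Union>f<m. child_wires k e f)"
    proof (rule wire_pairs_for)
      fix u :: state and f
      assume f: "f < m" "u ''f'' 0 = f"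
        and "\<And>z. z \<notin> insert ''f'' (writes ?p) \<Longrightarrow> u z = den ?own t z"
      then have u: "u z = t z" if "z \<notin> {''f'', ''c'', ''g'', ''src'', ''dst'', ''wires''}" for z
        using that by (simp add: den_frame)
      have us: "u z = s z" if "z \<notin> {''e'', ''f'', ''c'', ''g'', ''src'', ''dst'', ''wires''}" for z
        using u[of z] t[of z] that by simp
      have ue: "u ''e'' 0 = e" using e u[of "''e''"] by simp
      have env_u: "env u" by (rule env_cong[OF s(1)], rule us) auto
      have Q_u: "matrix ''Q'' (\<lambda>e h. cluster k h e) u" using s(2) us[of "''Q''"] by (simp add: matrix_def)
      have P_u: "u ''P'' (e * m + f) = of_bool (f \<in> members (Suc k) e)" if "f < m" for f
        using matrixD[OF s(3) e(1) that] us[of "''P''"] by (simp add: members_def)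
      have inc_u: "u ''inc'' (u ''r'' f + ord k) = of_bool (I f k)" if "f < m" for f
        using envD[OF env_u] that vals(2) by (simp add: I_def)
      have vals_u: "u ''x'' 0 = ord k" "u ''nodes'' 0 = base k" "u ''prev'' 0 = prev k"
        "u ''m'' 0 = m" "u ''q'' e = e * m"
        using vals us envD[OF env_u] e by simp_all
      let ?M = "members (Suc k) e"
      let ?N = "{h \<in> members (Suc k) e. \<not> I h k}"
      have M: "?M \<subseteq> {..<m}" by (rule members_bound[OF e(1)])
      show "wire_pairs (den ?p u) = wire_pairs u \<union> child_wires k e f"
      proof (cases "f \<in> ?M")
        case False
        then have "\<not> bval (nonzero (Cell ''P'' (entry (scal ''e'') (scal ''f'')))) u"
          using P_u f ue vals_u by (simp add: expr_defs)
        then show ?thesis using False by (simp add: child_wires_def)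
      next
        case True
        define w where "w = den ?q0 u"
        have test0: "den ?t0 u ''c'' 0 = of_bool (f \<in> tops (cluster k) ?N)" if "\<not> I f k"
        proof (rule TestTop_correct[OF env_u Q_u])
          show "f \<in> ?N" using True that by simp
          show "?N \<subseteq> {..<m}" using M by blast
          fix u' :: state and g
          assume "g < m" "u' ''g'' 0 = g" "\<And>z. z \<noteq> ''g'' \<Longrightarrow> z \<noteq> ''c'' \<Longrightarrow> u' z = u z"
          then show "bval (And (nonzero (Cell ''P'' (entry (scal ''e'') (scal ''g''))))
              (Not (incident_at (scal ''g'') (scal ''x'')))) u' \<longleftrightarrow> g \<in> ?N"
            using P_u[of g] inc_u[of g] ue vals_u by (simp add: expr_defs)
        qed (use f in simp_all)
        have w_wires: "wire_pairs w = wire_pairs u \<union> (if I f k then {(m + f, code (Case0 k e))}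
            else if f \<in> tops (cluster k) ?N then {(prev k + f, code (Case0 k e))} else {})"
          using test0 inc_u[of f] f ue vals_u
          by (simp add: w_def wire_pairs_AddWire wire_pairs_frame den_frame expr_defs add.assoc)
        have w: "w z = u z" if "z \<notin> {''c'', ''g'', ''src'', ''dst'', ''wires''}" for z
          using that by (simp add: w_def den_frame)
        have env_w: "env w" by (rule env_cong[OF env_u], rule w) auto
        have Q_w: "matrix ''Q'' (\<lambda>e h. cluster k h e) w" using Q_u w[of "''Q''"] by (simp add: matrix_def)
        have test1: "den ?t1 w ''c'' 0 = of_bool (f \<in> tops (cluster k) ?M)"
        proof (rule TestTop_correct[OF env_w Q_w _ f(1) True M])
          show "w ''f'' 0 = f" using f w by simp
          fix u' :: state and g
          assume "g < m" "u' ''g'' 0 = g" "\<And>z. z \<noteq> ''g'' \<Longrightarrow> z \<noteq> ''c'' \<Longrightarrow> u' z = w z"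
          then show "bval (nonzero (Cell ''P'' (entry (scal ''e'') (scal ''g'')))) u' \<longleftrightarrow> g \<in> ?M"
            using P_u[of g] ue vals_u w by (simp add: expr_defs)
        qed
        have "bval (nonzero (Cell ''P'' (entry (scal ''e'') (scal ''f'')))) u"
          using P_u[of f] True f ue vals_u by (simp add: expr_defs)
        then have "den ?p u = den ?i1 (den ?t1 w)" unfolding den.simps w_def by simp
        moreover have "wire_pairs (den ?i1 (den ?t1 w)) = wire_pairs w \<union>
            (if f \<in> tops (cluster k) ?M then {(prev k + f, code (Case1 k e))} else {})"
          using test1 f ue vals_u w
          by (simp add: wire_pairs_AddWire wire_pairs_frame den_frame expr_defs add.assoc)
        ultimately show ?thesis using True w_wires unfolding child_wires_def by auto
      qed
    qed (use e t envD[OF s(1)] in \<open>simp_all add: den_frame\<close>)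
    ultimately show "wire_pairs (den (?own ;; ?loop) t) =
        wire_pairs t \<union> (own_wires k e \<union> (\<Union>f<m. child_wires k e f))"
      by (simp add: Un_assoc del: den.simps add: den.simps(3))
  qed (use envD[OF s(1)] in simp_all)
  then show ?thesis unfolding Wires_def by (simp add: wire_set_stage wire_set_block)
qed


text \<open>
  The invariant of the main loop.  Here \<open>k\<close> stages are complete.
\<close>
definition stage_done :: "nat \<Rightarrow> state \<Rightarrow> bool" where
  "stage_done k s \<longleftrightarrow> env s \<and> removed (gone k) s \<and> matrix ''Q'' (\<lambda>e h. cluster k h e) s \<and>
     s ''nodes'' 0 = base k \<and> s ''prev'' 0 = prev k \<and> gates_written (nodes_upto k) s \<and>
     wire_pairs s = wire_set (nodes_upto k)"

lemma Stage_correct: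
  assumes s: "stage_done k s" and k: "ord k < n"
  shows "stage_done (Suc k) (den Stage s)"
proof -
  have env: "env s" and rem: "removed (gone k) s" and Q: "matrix ''Q'' (\<lambda>e h. cluster k h e) s"
    and nodes: "s ''nodes'' 0 = base k" and prev: "s ''prev'' 0 = prev k"
    and gates: "gates_written (nodes_upto k) s" and wires: "wire_pairs s = wire_set (nodes_upto k)"
    using s by (simp_all add: stage_done_def)
  have matrix_keep: "matrix a F (den p t)" if "matrix a F t" "a \<notin> writes p" for a F p t
    using that by (simp add: matrix_def den_frame)
  have env_keep: "env (den p t)" if "env t" "{''n'', ''m'', ''r'', ''q'', ''inc''} \<inter> writes p = {}" for p t
    using that(2) by (intro env_cong[OF that(1)] den_frame) auto
  define s1 where "s1 = den Traces s"
  define s2 where "s2 = den Pick s1"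
  define s3 where "s3 = den Merge s2"
  define s4 where "s4 = den Gates s3"
  define s5 where "s5 = den Wires s4"
  note state_defs = s1_def s2_def s3_def s4_def s5_def
  have env1: "env s1" and env2: "env s2" and env3: "env s3" and env4: "env s4" and env5: "env s5"
    unfolding state_defs by (intro env_keep env; simp)+
  have le1: "matrix ''le'' (trace_le (gone k)) s1"
    unfolding s1_def by (rule Traces_correct[OF env rem])
  have rem1: "removed (gone k) s1" using rem by (simp add: removed_def s1_def den_frame)
  have x2: "s2 ''x'' 0 = ord k"
    unfolding s2_def ord_def by (rule Pick_correct[OF env1 rem1 le1])
  have le2: "matrix ''le'' (trace_le (gone k)) s2"
    unfolding s2_def by (rule matrix_keep[OF le1]) simp
  have Q2: "matrix ''Q'' (\<lambda>e h. cluster k h e) s2"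
    unfolding s2_def s1_def by (intro matrix_keep Q; simp)
  have P3: "matrix ''P'' (\<lambda>e h. cluster (Suc k) h e) s3"
    unfolding s3_def by (rule Merge_correct[OF env2 le2 Q2 x2 k])
  have x3: "s3 ''x'' 0 = ord k" and nodes3: "s3 ''nodes'' 0 = base k"
    using x2 nodes by (simp_all add: s3_def den_frame) (simp add: s2_def s1_def den_frame)
  have gates4: "gates_written (stage_nodes k) s4"
    unfolding s4_def by (rule Gates_correct(1)[OF env3 nodes3 x3])
  have gates4': "gates_written (nodes_upto k) s4"
  proof (rule gates_written_cong[OF gates])
    fix d assume "d \<in> nodes_upto k"
    then have "code d < base k" by (rule code_less_base)
    then show "s4 ''kind'' (code d) = s ''kind'' (code d)" "s4 ''arg'' (code d) = s ''arg'' (code d)"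
      using Gates_correct(2,3)[OF env3 nodes3 x3]
      by (simp_all add: s4_def) (simp_all add: s3_def s2_def s1_def den_frame)
  qed
  have Q4: "matrix ''Q'' (\<lambda>e h. cluster k h e) s4"
    unfolding s4_def s3_def by (intro matrix_keep Q2; simp)
  have P4: "matrix ''P'' (\<lambda>e h. cluster (Suc k) h e) s4"
    unfolding s4_def by (intro matrix_keep P3; simp)
  have x4: "s4 ''x'' 0 = ord k" using x3 by (simp add: s4_def den_frame)
  have n4: "s4 ''nodes'' 0 = base k" using nodes3 by (simp add: s4_def den_frame)
  have p4: "s4 ''prev'' 0 = prev k"
    using prev by (simp add: state_defs den_frame)
  have "wire_pairs s4 = wire_pairs s"
    unfolding state_defs by (simp add: wire_pairs_frame)
  then have wires5: "wire_pairs s5 = wire_set (nodes_upto (Suc k))"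
    unfolding s5_def Wires_correct[OF env4 Q4 P4 x4 k n4 p4] by (simp add: wires wire_set_Un)
  have gates5: "gates_written (nodes_upto (Suc k)) s5"
  proof -
    have "gates_written (nodes_upto (Suc k)) s4" using gates4 gates4' by (simp add: gates_written_Un)
    then show ?thesis by (rule gates_written_cong) (simp_all add: s5_def den_frame)
  qed
  have P5: "matrix ''P'' (\<lambda>e h. cluster (Suc k) h e) s5"
    unfolding s5_def by (intro matrix_keep P4; simp)
  let ?copy = "LFor ''e'' ''m'' (LFor ''f'' ''m'' (LSet ''Q'' (entry (scal ''e'') (scal ''f''))
       (Cell ''P'' (entry (scal ''e'') (scal ''f'')))))"
  let ?tail = "LSet ''gone'' (scal ''x'') (Num 1) ;; LSet ''prev'' (Num 0) (split_at (Num 0)) ;;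
     LSet ''nodes'' (Num 0) (split_at (scal ''m''))"
  define s6 where "s6 = den ?copy s5"
  have Q6: "matrix ''Q'' (\<lambda>e h. cluster (Suc k) h e) s6"
    unfolding matrix_def s6_def
  proof (rule fill_matrix)
    fix t :: state and i j
    assume ij: "i < m" "j < m" "t ''e'' 0 = i" "t ''f'' 0 = j"
      and t: "\<And>z. z \<notin> insert ''e'' (insert ''f'' (writes (LSet ''Q'' (entry (scal ''e'') (scal ''f''))
       (Cell ''P'' (entry (scal ''e'') (scal ''f'')))))) \<Longrightarrow> t z = s5 z"
    then have "t ''q'' = s5 ''q''" "t ''P'' = s5 ''P''" by simp_all
    then show "den (LSet ''Q'' (entry (scal ''e'') (scal ''f''))
       (Cell ''P'' (entry (scal ''e'') (scal ''f'')))) t ''Q'' =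
      (t ''Q'')(i * m + j := of_bool (cluster (Suc k) j i))"
      using ij envD(4)[OF env5] matrixD[OF P5] by (simp add: expr_defs del: cluster.simps)
  qed (use envD[OF env5] in simp_all)
  have s6: "s6 z = s5 z" if "z \<notin> {''e'', ''f'', ''Q''}" for z
    using that by (simp add: s6_def den_frame)
  have v6: "s6 ''x'' 0 = ord k" "s6 ''nodes'' 0 = base k" "s6 ''m'' 0 = m"
    using x4 n4 envD(2)[OF env5] by (simp_all add: s6) (simp_all add: s5_def den_frame)
  define s7 where "s7 = den ?tail s6"
  have s7: "s7 z = s6 z" if "z \<notin> {''gone'', ''prev'', ''nodes''}" for z
    using that by (simp add: s7_def)
  have "den Stage s = s7"
    by (simp add: Stage_def Advance_def s7_def s6_def state_defs)
  moreover have "env s7" by (rule env_cong[OF env5]) (auto simp: s7 s6)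
  moreover have "removed (gone (Suc k)) s7"
  proof -
    have "s6 ''gone'' = s ''gone''" by (simp add: s6 state_defs den_frame)
    then have "s7 ''gone'' = (s ''gone'')(ord k := 1)" using v6 by (simp add: s7_def)
    then show ?thesis using rem by (auto simp: removed_def gone_Suc simp del: gone.simps)
  qed
  moreover have "matrix ''Q'' (\<lambda>e h. cluster (Suc k) h e) s7"
    using Q6 by (simp add: matrix_def s7 del: cluster.simps)
  moreover have "s7 ''nodes'' 0 = base (Suc k)" "s7 ''prev'' 0 = prev (Suc k)"
    using v6 by (simp_all add: s7_def expr_defs base_Suc prev_def)
  moreover have "gates_written (nodes_upto (Suc k)) s7"
    by (rule gates_written_cong[OF gates5]) (simp_all add: s7 s6)
  moreover have "wire_pairs s7 = wire_set (nodes_upto (Suc k))"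
    unfolding wires5[symmetric] by (rule wire_pairs_cong) (simp_all add: s7 s6)
  ultimately show ?thesis by (simp add: stage_done_def del: gone.simps cluster.simps nodes_upto.simps)
qed

definition start_state :: "state \<Rightarrow> bool" where
  "start_state s \<longleftrightarrow> s ''n'' 0 = n \<and> s ''m'' 0 = m \<and>
     (\<forall>e<m. \<forall>i<n. s ''inc'' (e * n + i) = of_bool (A e i)) \<and>
     (\<forall>z i. z \<notin> {''n'', ''m'', ''inc''} \<longrightarrow> s z i = 0)"

lemma Prepare_correct:
  assumes s: "start_state s"
  shows "stage_done 0 (den Prepare s)"
proof -
  have sm: "s ''m'' 0 = m" and sn: "s ''n'' 0 = n"
    and zero: "\<And>z i. z \<notin> {''n'', ''m'', ''inc''} \<Longrightarrow> s z i = 0"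
    and inc: "\<And>e i. e < m \<Longrightarrow> i < n \<Longrightarrow> s ''inc'' (e * n + i) = of_bool (A e i)"
    using s unfolding start_state_def by blast+
  let ?p = "LSet ''r'' (scal ''e'') (scal ''a'') ;; LSet ''q'' (scal ''e'') (scal ''b'') ;;
      LSet ''Q'' (Plus (scal ''b'') (scal ''e'')) (Num 1) ;;
      LSet ''a'' (Num 0) (Plus (scal ''a'') (scal ''n'')) ;;
      LSet ''b'' (Num 0) (Plus (scal ''b'') (scal ''m'')) ;;
      LSet ''kind'' (scal ''e'') (Num 3) ;;
      LSet ''arg'' (scal ''e'') (Plus (scal ''n'') (scal ''e'')) ;;
      LSet ''kind'' (Plus (scal ''m'') (scal ''e'')) (Num 4) ;;
      LSet ''arg'' (Plus (scal ''m'') (scal ''e'')) (Plus (scal ''n'') (scal ''e''))"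
  let ?Inv = "\<lambda>j t. t ''a'' 0 = j * n \<and> t ''b'' 0 = j * m \<and>
      (\<forall>e<j. t ''r'' e = e * n) \<and> (\<forall>e<j. t ''q'' e = e * m) \<and>
      (\<forall>c. t ''Q'' c = of_bool (\<exists>e<j. c = e * m + e)) \<and>
      (\<forall>e<j. t ''kind'' e = 3) \<and> (\<forall>e<j. t ''arg'' e = n + e) \<and>
      (\<forall>e<j. t ''kind'' (m + e) = 4) \<and> (\<forall>e<j. t ''arg'' (m + e) = n + e)"
  define u where "u = den (LFor ''e'' ''m'' ?p) s"
  have "?Inv (s ''m'' 0) u"
    unfolding u_def
  proof (rule for_invariant[where Inv = ?Inv])
    fix j t
    assume j: "j < s ''m'' 0" and te: "t ''e'' = (s ''e'')(0 := j)" and Inv: "?Inv j t"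
      and frame: "\<And>z. z \<notin> insert ''e'' (writes ?p) \<Longrightarrow> t z = s z"
    have jm: "j < m" using j sm by simp
    have "t ''n'' = s ''n''" "t ''m'' = s ''m''" by (rule frame; simp)+
    then have vals: "t ''e'' 0 = j" "t ''a'' 0 = j * n" "t ''b'' 0 = j * m" "t ''n'' 0 = n" "t ''m'' 0 = m"
      using te Inv sn sm by simp_all
    define t' where "t' = step_var ''e'' (den ?p t)"
    have t': "t' ''a'' 0 = j * n + n" "t' ''b'' 0 = j * m + m" "t' ''r'' = (t ''r'')(j := j * n)"
      "t' ''q'' = (t ''q'')(j := j * m)" "t' ''Q'' = (t ''Q'')(j * m + j := 1)"
      "t' ''kind'' = (t ''kind'')(j := 3, m + j := 4)"
      "t' ''arg'' = (t ''arg'')(j := n + j, m + j := n + j)"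
      using vals by (simp_all add: t'_def fun_eq_iff)
    show "?Inv (Suc j) t'"
    proof (intro conjI)
      show "t' ''a'' 0 = Suc j * n" "t' ''b'' 0 = Suc j * m" using t' by simp_all
      show "\<forall>e<Suc j. t' ''r'' e = e * n" "\<forall>e<Suc j. t' ''q'' e = e * m"
        using t' Inv by (simp_all add: less_Suc_eq)
      show "\<forall>c. t' ''Q'' c = of_bool (\<exists>e<Suc j. c = e * m + e)"
        using t'(5) Inv by (auto simp: less_Suc_eq)
      show "\<forall>e<Suc j. t' ''kind'' e = 3" "\<forall>e<Suc j. t' ''arg'' e = n + e"
        "\<forall>e<Suc j. t' ''kind'' (m + e) = 4" "\<forall>e<Suc j. t' ''arg'' (m + e) = n + e"
        using t'(6,7) Inv jm by (auto simp: less_Suc_eq)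
    qed
  qed (use zero in simp_all)
  then have u: "?Inv m u" using sm by simp
  have keep: "u z = s z" if "z \<notin> {''e'', ''r'', ''q'', ''Q'', ''a'', ''b'', ''kind'', ''arg''}" for z
    using that by (simp add: u_def den_frame)
  define w where "w = den Prepare s"
  have w_eq: "w = u(''nodes'' := (u ''nodes'')(0 := m + m))"
  proof -
    have "w = den (LSet ''nodes'' (Num 0) (Plus (scal ''m'') (scal ''m''))) u"
      by (simp only: w_def u_def Prepare_def den.simps(3))
    then show ?thesis using sm by (simp add: keep)
  qed
  have w: "w z = u z" if "z \<noteq> ''nodes''" for z using that by (simp add: w_eq)
  have "env w" using u sm sn inc by (simp add: env_def w keep)
  moreover have "removed (gone 0) w" using zero by (simp add: removed_def w keep)
  moreover have "matrix ''Q'' (\<lambda>e h. cluster 0 h e) w"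
    unfolding matrix_def
  proof (intro allI impI)
    fix e h assume "e < m" "h < m"
    then have "(\<exists>i<m. e * m + h = i * m + i) \<longleftrightarrow> h = e" by (auto simp: row_major_eq)
    moreover have "w ''Q'' (e * m + h) = of_bool (\<exists>i<m. e * m + h = i * m + i)"
      using u by (simp add: w)
    ultimately show "w ''Q'' (e * m + h) = of_bool (cluster 0 h e)" by simp
  qed
  moreover have "w ''nodes'' 0 = base 0" "w ''prev'' 0 = prev 0"
    using zero by (simp_all add: w_eq keep base_0 prev_def)
  moreover have "gates_written (nodes_upto 0) w"
    using u by (auto simp: gates_written_def w)
  moreover have "wire_pairs w = wire_set (nodes_upto 0)"
    using zero by (auto simp: wire_pairs_def wire_set_def w keep)
  ultimately show ?thesis by (simp add: stage_done_def w_def)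
qed

lemma Finish_correct:
  assumes s: "stage_done n s"
  shows "gates_written all_nodes (den Finish s)" "wire_pairs (den Finish s) = wire_set all_nodes"
    "den Finish s ''out'' 0 = code Root" "den Finish s ''nodes'' 0 = base n + 2"
proof -
  have env: "env s" and Q: "matrix ''Q'' (\<lambda>e h. cluster n h e) s"
    and nodes: "s ''nodes'' 0 = base n" and prev: "s ''prev'' 0 = prev n"
    and gates: "gates_written (nodes_upto n) s" and wires: "wire_pairs s = wire_set (nodes_upto n)"
    using s by (simp_all add: stage_done_def)
  let ?pre = "LSet ''kind'' (scal ''nodes'') (Num 2) ;; LSet ''kind'' (node_at (Num 1)) (Num 5) ;;
     AddWire (scal ''nodes'') (node_at (Num 1))"
  let ?t = "TestTop (Less (Num 0) (Num 1))"
  let ?i = "LIf (nonzero (scal ''c'')) (AddWire (sub_at (scal ''f'')) (node_at (Num 1))) LNop"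
  let ?loop = "LFor ''f'' ''m'' (?t ;; ?i)"
  define s1 where "s1 = den ?pre s"
  define s2 where "s2 = den ?loop s1"
  have s1: "s1 z = s z" if "z \<notin> {''kind'', ''src'', ''dst'', ''wires''}" for z
    using that by (simp add: s1_def den_frame)
  have kind1: "s1 ''kind'' = (s ''kind'')(base n := 2, base n + 1 := 5)"
    using nodes by (simp add: s1_def den_frame expr_defs fun_eq_iff)
  have wires1: "wire_pairs s1 = insert (base n, base n + 1) (wire_pairs s)"
    using nodes by (simp add: s1_def wire_pairs_AddWire expr_defs)
  have s2: "s2 z = s1 z" if "z \<notin> {''f'', ''c'', ''g'', ''src'', ''dst'', ''wires''}" for z
    using that by (simp add: s2_def den_frame)
  let ?T = "tops (cluster n) {..<m}"
  have "wire_pairs s2 = wire_pairs s1 \<union>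
      (\<Union>f<m. if f \<in> ?T then {(prev n + f, base n + 1)} else {})"
    unfolding s2_def
  proof (rule wire_pairs_for)
    fix t :: state and f
    assume f: "f < m" "t ''f'' 0 = f" and frame: "\<And>z. z \<notin> insert ''f'' (writes (?t ;; ?i)) \<Longrightarrow> t z = s1 z"
    have t: "t z = s z" if "z \<notin> {''f'', ''c'', ''g'', ''src'', ''dst'', ''wires'', ''kind''}" for z
      using frame[of z] s1[of z] that by simp
    have "env t" by (rule env_cong[OF env]) (auto simp: t)
    moreover have "matrix ''Q'' (\<lambda>e h. cluster n h e) t" using Q by (simp add: matrix_def t)
    ultimately have "den ?t t ''c'' 0 = of_bool (f \<in> ?T)"
      using f by (intro TestTop_correct) simp_all
    moreover have "t ''nodes'' 0 = base n" "t ''prev'' 0 = prev n"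
      using nodes prev by (simp_all add: t)
    ultimately show "wire_pairs (den (?t ;; ?i) t) =
        wire_pairs t \<union> (if f \<in> ?T then {(prev n + f, base n + 1)} else {})"
      using f by (simp add: wire_pairs_AddWire wire_pairs_frame den_frame expr_defs)
  qed (use envD[OF env] in \<open>simp_all add: s1\<close>)
  moreover have "(\<Union>f<m. if f \<in> ?T then {(prev n + f, base n + 1)} else {}) =
      (\<lambda>f. (prev n + f, base n + 1)) ` ?T"
    using tops_subset[of "cluster n" "{..<m}"] by (auto split: if_splits)
  moreover have "wire_set {Triv, Root} = insert (base n, base n + 1)
      ((\<lambda>f. (prev n + f, base n + 1)) ` ?T)"
    by (simp add: wire_set_def image_image code_sub_node)
  moreover have "wire_set all_nodes = wire_set (nodes_upto n) \<union> wire_set {Triv, Root}"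
    by (simp only: all_nodes_def wire_set_Un)
  ultimately have wires2: "wire_pairs s2 = wire_set all_nodes"
    using wires1 wires by simp
  define s3 where "s3 = den Finish s"
  have s3_eq: "s3 = s2(''out'' := (s2 ''out'')(0 := base n + 1), ''nodes'' := (s2 ''nodes'')(0 := base n + 2))"
  proof -
    have "s3 = den (LSet ''out'' (Num 0) (node_at (Num 1)) ;;
        LSet ''nodes'' (Num 0) (node_at (Num 2))) s2"
      by (simp only: s3_def s2_def s1_def Finish_def den.simps(3))
    then show ?thesis using nodes by (simp add: expr_defs s2 s1)
  qed
  have "wire_pairs s3 = wire_pairs s2" by (rule wire_pairs_cong) (simp_all add: s3_eq)
  then show "wire_pairs (den Finish s) = wire_set all_nodes" using wires2 by (simp add: s3_def)
  show "den Finish s ''out'' 0 = code Root" "den Finish s ''nodes'' 0 = base n + 2"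
    unfolding s3_def[symmetric] by (simp_all add: s3_eq)
  have kind3: "s3 ''kind'' = (s ''kind'')(base n := 2, base n + 1 := 5)" and arg3: "s3 ''arg'' = s ''arg''"
    using kind1 by (simp_all add: s3_eq s2 s1)
  have "gates_written (nodes_upto n) s3"
  proof (rule gates_written_cong[OF gates])
    fix d assume "d \<in> nodes_upto n"
    then have "code d < base n" by (rule code_less_base)
    then show "s3 ''kind'' (code d) = s ''kind'' (code d)" "s3 ''arg'' (code d) = s ''arg'' (code d)"
      by (simp_all add: kind3 arg3)
  qed
  moreover have "gates_written {Triv, Root} s3" by (simp add: gates_written_def kind3)
  ultimately show "gates_written all_nodes (den Finish s)"
    unfolding all_nodes_def gates_written_Un s3_def by blast
qed

end

context eliminable
begin

lemma Compiler_correct: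
  assumes s: "start_state s"
  shows "gates_written all_nodes (den Compiler s)" "wire_pairs (den Compiler s) = wire_set all_nodes"
    "den Compiler s ''out'' 0 = code Root" "den Compiler s ''nodes'' 0 = base n + 2"
proof -
  let ?s = "den Prepare s"
  have start: "stage_done 0 ?s" by (rule Prepare_correct[OF s])
  have k_keep: "stage_done k (t(''k'' := v))" if "stage_done k t" for k t v
    using that unfolding stage_done_def env_def removed_def matrix_def gates_written_def wire_pairs_def
    by simp
  have sn: "?s ''n'' 0 = n" using start by (simp add: stage_done_def env_def)
  have "stage_done (?s ''n'' 0) (den (LFor ''k'' ''n'' Stage) ?s)"
  proof (rule for_invariant)
    show "''k'' \<notin> writes Stage" by (simp add: Stage_def)
    show "stage_done 0 (?s(''k'' := (?s ''k'')(0 := 0)))" by (rule k_keep[OF start])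
    fix k t assume k: "k < ?s ''n'' 0" and t: "stage_done k t"
    have "stage_done (Suc k) (den Stage t)" using Stage_correct[OF t] ord_bound k sn by simp
    then show "stage_done (Suc k) (step_var ''k'' (den Stage t))"
      unfolding step_var_def by (rule k_keep)
  qed
  then have "stage_done n (den (LFor ''k'' ''n'' Stage) ?s)" using sn by simp
  from Finish_correct[OF this]
  show "gates_written all_nodes (den Compiler s)" "wire_pairs (den Compiler s) = wire_set all_nodes"
    "den Compiler s ''out'' 0 = code Root" "den Compiler s ''nodes'' 0 = base n + 2"
    by (simp_all only: Compiler_def den.simps(3))
qed

end

section \<open>Compilation of beta-acyclic hypergraphs\<close>

text \<open>
  Take the first vertex \<open>us ! i\<close> of an elimination order that is not in \<open>W\<close>.  The set \<open>T\<close> of its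
  predecessors is contained in \<open>W\<close>, and traces that form a chain after removal of \<open>T\<close> still do so
  after removal of \<open>W\<close>.
\<close>
lemma beta_acyclic_eliminable:
  assumes beta: "beta_acyclic V E" and vs: "distinct vs" "set vs = V" and es: "set es = E"
  shows "eliminable (length vs) (length es) (\<lambda>j i. vs ! i \<in> es ! j)"
proof
  interpret incidence "length vs" "length es" "\<lambda>j i. vs ! i \<in> es ! j" .
  fix W assume W: "W \<subset> {..<length vs}"
  obtain us where us: "set us = V" and nest_us: "\<And>i. i < length us \<Longrightarrow>
      nest_point (V - set (take i us)) (delete_from_edges E (set (take i us))) (us ! i)"
    using beta unfolding beta_acyclic_def by blast
  have in_W: "vs ! i \<in> (!) vs ` W \<longleftrightarrow> i \<in> W" if "i < length vs" for i
    using that W vs(1) by (auto simp: nth_eq_iff_index_eq)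
  obtain j where j: "j < length vs" "j \<notin> W" using psubset_imp_ex_mem[OF W] by auto
  have "vs ! j \<in> set us" using nth_mem[OF j(1)] us vs(2) by simp
  then have ex: "\<exists>i. i < length us \<and> us ! i \<notin> (!) vs ` W"
    using in_W[OF j(1)] j(2) by (metis in_set_conv_nth)
  define i where "i = (LEAST i. i < length us \<and> us ! i \<notin> (!) vs ` W)"
  have i: "i < length us" "us ! i \<notin> (!) vs ` W"
    using LeastI_ex[OF ex] unfolding i_def by blast+
  have earlier: "us ! l \<in> (!) vs ` W" if "l < i" for l
    using not_less_Least[of l "\<lambda>i. i < length us \<and> us ! i \<notin> (!) vs ` W"] that i(1)
    unfolding i_def by simp
  \<comment> \<open>removed before \<open>us ! i\<close> in the given order\<close>
  define T where "T = set (take i us)"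
  have T: "T \<subseteq> (!) vs ` W" using earlier by (auto simp: T_def in_set_conv_nth)
  have "us ! i \<in> set vs" using nth_mem[OF i(1)] us vs(2) by simp
  then obtain v where v: "v < length vs" "vs ! v = us ! i" by (metis in_set_conv_nth)
  have "nest_point (V - T) (delete_from_edges E T) (vs ! v)"
    using nest_us[OF i(1)] unfolding T_def v(2) .
  then have chain: "chain\<^sub>\<subseteq> {e \<in> delete_from_edges E T. vs ! v \<in> e}" and vT: "vs ! v \<notin> T"
    unfolding nest_point_def by blast+
  have "nest W v"
    unfolding nest_def
  proof (intro conjI allI impI)
    show "v \<notin> W" using in_W[OF v(1)] i(2) v(2) by simp
    fix e f
    assume ef: "e < length es" "f < length es" "vs ! v \<in> es ! e" "vs ! v \<in> es ! f"
    have mem: "es ! j - T \<in> {e \<in> delete_from_edges E T. vs ! v \<in> e}"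
      if "j < length es" "vs ! v \<in> es ! j" for j
      using nth_mem[OF that(1)] that(2) es vT unfolding delete_from_edges_def by simp
    have "es ! e - T \<subseteq> es ! f - T \<or> es ! f - T \<subseteq> es ! e - T"
      using bspec[OF bspec[OF chain[unfolded chain_subset_def] mem[OF ef(1,3)]] mem[OF ef(2,4)]] .
    moreover have "trace_le W e f" if "es ! e - T \<subseteq> es ! f - T" for e f
      unfolding trace_le_def
    proof (intro allI impI)
      fix l assume "l < length vs" "l \<notin> W" "vs ! l \<in> es ! e"
      then show "vs ! l \<in> es ! f" using in_W[of l] T that by blast
    qed
    ultimately show "trace_le W e f \<or> trace_le W f e" by blast
  qed
  then show "\<exists>v<length vs. nest W v" using v(1) by blast
qed

lemma prod_of_bool: "finite S \<Longrightarrow> (\<Prod>v\<in>S. of_bool (P v)) = (of_bool (\<forall>v\<in>S. P v) :: nat)"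
  by (induction S rule: finite_induct) auto

lemma multilinear_set_lists:
  fixes vs :: "'a list" and es
  defines "zs \<equiv> mlvar_list vs es"
  assumes "hypergraph V E" "set vs = V" "set es = E"
  shows "multilinear_set V E = {\<tau> \<in> assignments (set zs). \<forall>h<length es.
    \<tau> (zs ! (length vs + h)) \<longleftrightarrow> (\<forall>i<length vs. vs ! i \<in> es ! h \<longrightarrow> \<tau> (zs ! i))}"
proof -
  have "mlvars V E = set zs"
    using assms by (auto simp: mlvars_def mlvar_list_def)
  moreover have "(\<forall>e\<in>E. (of_bool (\<tau> (Yvar e)) :: nat) = (\<Prod>v\<in>e. of_bool (\<tau> (Xvar v)))) \<longleftrightarrow>
    (\<forall>h<length es. \<tau> (zs ! (length vs + h)) \<longleftrightarrow> (\<forall>i<length vs. vs ! i \<in> es ! h \<longrightarrow> \<tau> (zs ! i)))" for \<tau>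
  proof -
    have "(of_bool (\<tau> (Yvar e)) :: nat) = (\<Prod>v\<in>e. of_bool (\<tau> (Xvar v))) \<longleftrightarrow>
        (\<tau> (Yvar e) \<longleftrightarrow> (\<forall>i<length vs. vs ! i \<in> e \<longrightarrow> \<tau> (Xvar (vs ! i))))" if "e \<in> E" for e
    proof -
      have "e \<subseteq> set vs" "finite e"
        using assms that unfolding hypergraph_def by (auto intro: finite_subset)
      moreover from this have "(\<forall>v\<in>e. \<tau> (Xvar v)) \<longleftrightarrow>
          (\<forall>i<length vs. vs ! i \<in> e \<longrightarrow> \<tau> (Xvar (vs ! i)))"
        by (metis in_set_conv_nth subsetD)
      ultimately show ?thesis by (simp add: prod_of_bool)
    qed
    then have "(\<forall>e\<in>E. (of_bool (\<tau> (Yvar e)) :: nat) = (\<Prod>v\<in>e. of_bool (\<tau> (Xvar v)))) \<longleftrightarrow>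
        (\<forall>e\<in>set es. \<tau> (Yvar e) \<longleftrightarrow> (\<forall>i<length vs. vs ! i \<in> e \<longrightarrow> \<tau> (Xvar (vs ! i))))"
      using assms by simp
    also have "\<dots> \<longleftrightarrow> (\<forall>h<length es. \<tau> (Yvar (es ! h)) \<longleftrightarrow>
        (\<forall>i<length vs. vs ! i \<in> es ! h \<longrightarrow> \<tau> (Xvar (vs ! i))))"
      by (simp add: all_set_conv_all_nth)
    finally show ?thesis by (simp add: zs_def mlvar_list_def nth_append)
  qed
  ultimately show ?thesis by (simp add: multilinear_set_def)
qed

lemma start_state_input:
  "incidence.start_state (length vs) (length es) (\<lambda>j i. vs ! i \<in> es ! j) (input_state vs es)"
proof -
  interpret incidence "length vs" "length es" "\<lambda>j i. vs ! i \<in> es ! j" .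
  have "e * length vs + i < length es * length vs" if "e < length es" "i < length vs" for e i
  proof -
    have "e * length vs + i < Suc e * length vs" using that by simp
    also have "\<dots> \<le> length es * length vs" using that by (intro mult_le_mono1) simp
    finally show ?thesis .
  qed
  moreover have "(e * length vs + i) div length vs = e" if "i < length vs" for e i
    using that by (cases "vs = []") simp_all
  ultimately show ?thesis by (auto simp: start_state_def input_state_def)
qed

context eliminable
begin

text \<open>
  The final memory determines the nodes, their kinds and the wires, but not the gates as terms.
  They are chosen by inverting the numbering of the nodes.
\<close>
lemma compiled_circuit:
  assumes s: "start_state s" and zs: "distinct zs" "length zs = n + m"
  defines "s' \<equiv> den Compiler s"
  obtains C where "encodes_circuit zs s' C" "built_circuit n m A zs C"
proof
  let ?C = "\<lparr>nodes = {..<base n + 2}, wires = wire_set all_nodes,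
    gate_of = (\<lambda>u. gate zs (inv_into all_nodes code u)), out_node = code Root\<rparr>"
  have gate: "gate_of ?C (code d) = gate zs d" if "d \<in> all_nodes" for d
    using that by (simp add: inv_into_f_f[OF code_inj])
  show "built_circuit n m A zs ?C"
    by unfold_locales (use zs gate in simp_all)
  note correct = Compiler_correct[OF s, folded s'_def]
  have "encodes_gate zs (s' ''kind'' u) (s' ''arg'' u) (gate_of ?C u)" if u: "u \<in> nodes ?C" for u
  proof -
    have "u \<in> code ` all_nodes" using u by (simp add: code_all_nodes)
    then obtain d where d: "d \<in> all_nodes" "u = code d" by blast
    have "s' ''kind'' u = kind_of d" "kind_of d \<in> {3, 4} \<Longrightarrow> s' ''arg'' u = arg_of d"
      using correct(1) d unfolding gates_written_def by blast+
    moreover have "encodes_gate zs (kind_of d) p (gate zs d)"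
      if "kind_of d \<in> {3, 4} \<Longrightarrow> p = arg_of d" for p
      using d(1) that zs(2)
      by (cases rule: all_nodes_cases) (simp_all add: ord_bound trans_less_add1)
    ultimately show ?thesis using gate[OF d(1)] d(2) by simp
  qed
  then show "encodes_circuit zs s' ?C"
    unfolding encodes_circuit_def using correct(2-4) by (simp add: wire_pairs_def)
qed

end

theorem theorem8:
  "\<exists>(prog :: com) (size_bound :: nat poly poly) (time_bound :: nat poly poly).
     \<forall>(V :: 'a set) (E :: 'a set set) (vs :: 'a list) (es :: 'a set list).
       hypergraph V E \<longrightarrow> beta_acyclic V E \<longrightarrow>
       distinct vs \<longrightarrow> set vs = V \<longrightarrow> distinct es \<longrightarrow> set es = E \<longrightarrow>
       (\<exists>(t :: nat) (s :: state) (C :: (nat, 'a mlvar) circuit).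
          run prog (input_state vs es) t s \<and>
          t \<le> poly2 time_bound (card V) (card E) \<and>
          encodes_circuit (mlvar_list vs es) s C \<and>
          d_DNNF (mlvars V E) C \<and>
          computed_set (mlvars V E) C = multilinear_set V E \<and>
          circuit_size C \<le> poly2 size_bound (card V) (card E))"
proof -
  let ?x = "[:0, 1:] :: nat poly poly" and ?y = "[:[:0, 1:]:] :: nat poly poly"
  define size_bound where "size_bound = (2 * ?y + ?x * (3 * ?y + 2) + 2) ^ 2"
  have size_bound: "poly2 size_bound x y = (2 * y + x * (3 * y + 2) + 2) ^ 2" for x y
    unfolding size_bound_def by (simp only: poly2_simps poly2_power)
  show ?thesis
  proof (rule exI[of _ "compile Compiler"], rule exI[of _ size_bound],
      rule exI[of _ "cost Compiler"], intro allI impI)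
    fix V :: "'a set" and E :: "'a set set" and vs :: "'a list" and es :: "'a set list"
    assume H: "hypergraph V E" "beta_acyclic V E"
      and vs: "distinct vs" "set vs = V" and es: "distinct es" "set es = E"
    let ?zs = "mlvar_list vs es"
    have card: "card V = length vs" "card E = length es"
      using vs es distinct_card by blast+
    interpret eliminable "length vs" "length es" "\<lambda>j i. vs ! i \<in> es ! j"
      by (rule beta_acyclic_eliminable[OF H(2) vs es(2)])
    have zs: "distinct ?zs" "length ?zs = length vs + length es" "set ?zs = mlvars V E"
      using vs es by (auto simp: mlvar_list_def mlvars_def distinct_map inj_on_def)
    have input: "input_state vs es ''n'' 0 = length vs" "input_state vs es ''m'' 0 = length es"
      by (simp_all add: input_state_def)
    obtain t where t: "t \<le> poly2 (cost Compiler) (length vs) (length es)"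
      "run (compile Compiler) (input_state vs es) t (den Compiler (input_state vs es))"
      using run_compile[of Compiler "input_state vs es", OF well_formed_Compiler input] by blast
    obtain C where C: "encodes_circuit ?zs (den Compiler (input_state vs es)) C"
      "built_circuit (length vs) (length es) (\<lambda>j i. vs ! i \<in> es ! j) ?zs C"
      using compiled_circuit[OF start_state_input zs(1,2)] by blast
    interpret built: built_circuit "length vs" "length es" "\<lambda>j i. vs ! i \<in> es ! j" ?zs C
      by (rule C(2))
    have "circuit_size C \<le> poly2 size_bound (card V) (card E)"
      using built.circuit_size_built by (simp add: size_bound card base_def)
    moreover have "computed_set (mlvars V E) C = multilinear_set V E"
      using built.computed_set_built multilinear_set_lists[OF H(1) vs(2) es(2)] zs(3) by simp
    moreover have "d_DNNF (mlvars V E) C" using built.d_DNNF_built zs(3) by simp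
    ultimately show "\<exists>t s C. run (compile Compiler) (input_state vs es) t s \<and>
        t \<le> poly2 (cost Compiler) (card V) (card E) \<and> encodes_circuit ?zs s C \<and>
        d_DNNF (mlvars V E) C \<and> computed_set (mlvars V E) C = multilinear_set V E \<and>
        circuit_size C \<le> poly2 size_bound (card V) (card E)"
      using t C(1) card by metis
  qed
qed

end
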